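(* Let $\mathbb{X}=\mathbb{R}$ with the Borel $\sigma$-field, $\lambda$ the Lebesgue measure, and $\mu$ the normal distribution $N(m,\sigma^2)$, $\sigma>0$. Suppose $P\in\mathbb{E}$ with $P_n\ll\lambda^n$ for all $n$, $|\mathbb{E}X_i|<\infty$, $\mathrm{Var}\,X_i<\infty$, and $|h_\lambda|<\infty$. Then $$\lim_{n\to\infty}\frac1n\Big[-\log\mathrm{NPD}_\mu(X_{1:n})+\Big(\sum_{i=1}^n\frac{(X_i-m)^2}{2\sigma^2}\Big)\log e\Big]+\log(\sigma\sqrt{2\pi})=h_\lambda\quad P\text{-a.s.}$$
   Context: On $\mathbb{R}^{\mathbb{Z}}$, $X_k$ are coordinate maps, $x_{j:k}=(x_j,\dots,x_k)$, $P_n(A)=P(X_{1:n}\in A)$, $P_\lambda=dP_n/d\lambda^n$. $\mathbb{E}$: shift-stationary ergodic probability measures; $h_\lambda=\lim_n\mathbb{E}[-\log P_\lambda(X_{1:n})]/n$ (differential entropy rate). NPD density w.r.t. $\mu$: fix finite $\sigma$-fields $\mathcal{X}_0\subset\mathcal{X}_1\subset\cdots$ on $\mathbb{R}$ with $\mathcal{X}_0=\{\emptyset,\mathbb{R}\}$ generating the Borel $\sigma$-field; let $\chi_l$ be the finite partition generating $\mathcal{X}_l$; $x^l$ is the cell of $\chi_l$ containing $x$, $x^l_{1:n}=(x^l_1,\dots,x^l_n)$. Treat $\chi_l$ as a finite alphabet and let $R^l$ be a probability measure on $\chi_l^{\mathbb{Z}}$ universal with respect to the alphabet $\chi_l$ (for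 every stationary ergodic process $(Y_i)$ over $\chi_l$ with Shannon entropy rate $H$, $-\frac1n\log R^l(Y_{1:n})\to H$ a.s., in expectation and in probability). $\mathrm{NPD}^l_\mu(x_{1:n})=R^l(x^l_{1:n})/\prod_{i=1}^n\mu(x^l_i)$, $\mathrm{NPD}_\mu(x_{1:n})=\sum_{l\ge0}w_l\mathrm{NPD}^l_\mu(x_{1:n})$, $w_l=\frac1{l+1}-\frac1{l+2}$. *)

theory Defs
  imports "HOL-Probability.Probability"
begin

text \<open>All logarithms are to base 2 (the paper's log; log e = log 2 (exp 1)).\<close>

definition shift :: "(int \<Rightarrow> 'a) \<Rightarrow> int \<Rightarrow> 'a" where
  "shift x = (\<lambda>i. x (i + 1))"

definition stationary_ergodic :: "'a measure \<Rightarrow> (int \<Rightarrow> 'a) measure \<Rightarrow> bool" where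
  "stationary_ergodic M P \<longleftrightarrow>
     prob_space P \<and> sets P = sets (Pi\<^sub>M (UNIV :: int set) (\<lambda>_. M)) \<and>
     distr P P shift = P \<and>
     (\<forall>A \<in> sets P. shift -` A \<inter> space P = A \<longrightarrow> emeasure P A = 0 \<or> emeasure P A = 1)"

definition leb_n :: "nat \<Rightarrow> (int \<Rightarrow> real) measure" where
  "leb_n n = Pi\<^sub>M {1..int n} (\<lambda>_. lborel)"

definition marg_n :: "(int \<Rightarrow> real) measure \<Rightarrow> nat \<Rightarrow> (int \<Rightarrow> real) measure" where
  "marg_n P n = distr P (Pi\<^sub>M {1..int n} (\<lambda>_. borel)) (\<lambda>x. restrict x {1..int n})"

definition dens_n :: "(int \<Rightarrow> real) measure \<Rightarrow> nat \<Rightarrow> (int \<Rightarrow> real) \<Rightarrow> real" where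
  "dens_n P n x = enn2real (RN_deriv (leb_n n) (marg_n P n) (restrict x {1..int n}))"

definition word_cyl :: "(int \<Rightarrow> 'a) measure \<Rightarrow> 'a list \<Rightarrow> (int \<Rightarrow> 'a) set" where
  "word_cyl Q w = {y \<in> space Q. \<forall>i < length w. y (int i + 1) = w ! i}"

text \<open>Shannon entropy of Y_{1:n} (0 log 0 = 0 holds automatically since 0 * _ = 0).\<close>
definition block_entropy :: "(int \<Rightarrow> 'a) measure \<Rightarrow> 'a set \<Rightarrow> nat \<Rightarrow> real" where
  "block_entropy Q A n =
     - (\<Sum>w \<in> {w. length w = n \<and> set w \<subseteq> A}.
          measure Q (word_cyl Q w) * log 2 (measure Q (word_cyl Q w)))"

definition prefix_prob :: "(int \<Rightarrow> 'a) measure \<Rightarrow> (int \<Rightarrow> 'a) \<Rightarrow> nat \<Rightarrow> real" where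
  "prefix_prob R y n = measure R {z \<in> space R. \<forall>i \<in> {1..int n}. z i = y i}"

definition universal :: "'a set \<Rightarrow> (int \<Rightarrow> 'a) measure \<Rightarrow> bool" where
  "universal A R \<longleftrightarrow>
     prob_space R \<and> sets R = sets (Pi\<^sub>M (UNIV :: int set) (\<lambda>_. count_space A)) \<and>
     (\<forall>(Q :: (int \<Rightarrow> 'a) measure) (H :: real).
        stationary_ergodic (count_space A) Q \<and>
        (\<lambda>n. block_entropy Q A n / real n) \<longlonglongrightarrow> H \<longrightarrow>
          (AE y in Q. (\<forall>n. prefix_prob R y n > 0) \<and>
                      (\<lambda>n. - log 2 (prefix_prob R y n) / real n) \<longlonglongrightarrow> H) \<and>
          (\<lambda>n. \<integral>y. - log 2 (prefix_prob R y n) / real n \<partial>Q) \<longlonglongrightarrow> H \<and>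
          (\<forall>\<epsilon> > 0. (\<lambda>n. measure Q {y \<in> space Q.
                \<bar>- log 2 (prefix_prob R y n) / real n - H\<bar> > \<epsilon>}) \<longlonglongrightarrow> 0))"

definition nested_partitions :: "(nat \<Rightarrow> real set set) \<Rightarrow> bool" where
  "nested_partitions Ch \<longleftrightarrow>
     (\<forall>l. finite (Ch l) \<and> (\<forall>c \<in> Ch l. c \<in> sets borel \<and> c \<noteq> {}) \<and>
          disjoint (Ch l) \<and> \<Union>(Ch l) = UNIV) \<and>
     Ch 0 = {UNIV} \<and>
     (\<forall>l. sigma_sets UNIV (Ch l) \<subseteq> sigma_sets UNIV (Ch (Suc l))) \<and>
     sigma_sets UNIV (\<Union>l. sigma_sets UNIV (Ch l)) = sets borel"

definition cell :: "real set set \<Rightarrow> real \<Rightarrow> real set" where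
  "cell C v = (THE c. c \<in> C \<and> v \<in> c)"

definition npd_level :: "(nat \<Rightarrow> real set set) \<Rightarrow> (nat \<Rightarrow> (int \<Rightarrow> real set) measure)
    \<Rightarrow> real measure \<Rightarrow> nat \<Rightarrow> (int \<Rightarrow> real) \<Rightarrow> nat \<Rightarrow> real" where
  "npd_level Ch R \<mu> l x n =
     prefix_prob (R l) (\<lambda>i. cell (Ch l) (x i)) n /
       (\<Prod>i \<in> {1..int n}. measure \<mu> (cell (Ch l) (x i)))"

definition npd_weight :: "nat \<Rightarrow> real" where
  "npd_weight l = 1 / (real l + 1) - 1 / (real l + 2)"

definition NPD :: "(nat \<Rightarrow> real set set) \<Rightarrow> (nat \<Rightarrow> (int \<Rightarrow> real set) measure)
    \<Rightarrow> real measure \<Rightarrow> (int \<Rightarrow> real) \<Rightarrow> nat \<Rightarrow> real" where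
  "NPD Ch R \<mu> x n = (\<Sum>l. npd_weight l * npd_level Ch R \<mu> l x n)"

definition normal_measure :: "real \<Rightarrow> real \<Rightarrow> real measure" where
  "normal_measure m \<sigma> = density lborel (\<lambda>x. ennreal (normal_density m \<sigma> x))"

end

theory Submission
  imports Defs "HOL-Real_Asymp.Real_Asymp"
begin

text \<open>
  Let \<open>M\<close> be the product of the reference measure \<open>\<mu>\<close> over the integers, \<open>f n\<close> the density of \<open>P\<close> with respect
  to \<open>M\<close> on the coordinates \<open>1, \<dots>, n\<close>, and \<open>D = lim E log (f n) / n\<close>. Since the sum of the terms
  \<open>log (normal_density m \<sigma> (x i))\<close> obeys the ergodic theorem, it suffices that \<open>log NPD / n\<close> tends to \<open>D\<close>
  almost surely.

  The lower bound compares NPD with a single level \<open>l\<close>. By universality its rate is \<open>- H - E log \<mu>(cell)\<close>, where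
  by subadditivity the entropy rate \<open>H\<close> is at most the normalized entropy of blocks of length \<open>n\<close>. So the rate is
  at least the normalized relative entropy of the quantized block, and by the Donsker-Varadhan inequality the
  latter comes close to \<open>E log (f n) / n\<close> once \<open>log (f n)\<close> is approximated by functions of the cells.

  The upper bound holds for every sequence \<open>u n\<close> of sub-probability densities with respect to \<open>M\<close>; this avoids both
  the Shannon-McMillan-Breiman theorem for densities and conditioning on the infinite past. If \<open>u n > 2 powr (c n)\<close>
  infinitely often with positive probability for some \<open>c > D\<close>, then by ergodicity almost every trajectory can be
  tiled, up to few exceptional places, by blocks on which \<open>u\<close> is that large. A mixture over all tilings is a
  sub-probability density whose expected logarithm is about \<open>c N\<close>, and by Gibbs' inequality that is at most
  \<open>E log (f N)\<close>, which is about \<open>D N\<close>.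
\<close>

section \<open>Stationary ergodic processes\<close>

text \<open>Unless they coincide, \<open>P\<close> and \<open>M\<close> are mutually singular on
  whole sequences, since both are ergodic under the shift. Hence a density exists on finite blocks
  only, and integrals and null sets pass from \<open>M\<close> to \<open>P\<close> only for
  functions of a block. The reference measure is a product because a mixture over tilings must again
  have integral at most 1: under \<open>M\<close> a block and the remainder of the word are
  independent, so the bound follows by induction on the length, like Kraft's inequality for
  concatenated codewords. The weights of the block lengths decay polynomially, so the price of a
  block is logarithmic in its length and does not affect a rate. Single letters are allowed in a
  tiling because recurrence says only that a large value of \<open>u\<close> appears after some
  waiting time, and because the last block need not fit.\<close>

definition shift_by :: "nat \<Rightarrow> (int \<Rightarrow> 'a) \<Rightarrow> int \<Rightarrow> 'a" where
  "shift_by k x = (\<lambda>i. x (i + int k))"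

lemma shift_by_0 [simp]: "shift_by 0 x = x"
  by (simp add: shift_by_def)

lemma shift_by_shift_by [simp]: "shift_by k (shift_by j x) = shift_by (k + j) x"
  by (simp add: shift_by_def add_ac)

lemma shift_by_Suc: "shift_by (Suc k) x = shift_by k (shift x)"
  by (simp add: shift_by_def shift_def add_ac)

lemma shift_conv_shift_by: "shift = shift_by (Suc 0)"
  by (simp add: fun_eq_iff shift_by_def shift_def)

lemma measurable_shift_by_PiM [measurable]:
  "shift_by k \<in> measurable (\<Pi>\<^sub>M i\<in>(UNIV :: int set). M) (\<Pi>\<^sub>M i\<in>(UNIV :: int set). M)"
  unfolding shift_by_def by (rule measurable_PiM_single') (auto simp: space_PiM PiE_UNIV_domain)

locale stationary_process =
  fixes P :: "(int \<Rightarrow> real) measure"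
  assumes stationary_ergodic_P: "stationary_ergodic borel P"
begin

sublocale prob_space P
  using stationary_ergodic_P by (simp add: stationary_ergodic_def)

lemma sets_P [measurable_cong]: "sets P = sets (\<Pi>\<^sub>M i\<in>(UNIV :: int set). borel)"
  using stationary_ergodic_P by (simp add: stationary_ergodic_def)

lemma space_P [simp]: "space P = UNIV"
  using sets_eq_imp_space_eq[OF sets_P] by (simp add: space_PiM PiE_UNIV_domain)

lemma measurable_shift_by [measurable]: "shift_by k \<in> measurable P P"
  using measurable_shift_by_PiM[of k borel]
  by (simp cong: measurable_cong_sets add: measurable_cong_sets[OF sets_P sets_P])

lemma distr_shift_by: "distr P P (shift_by k) = P"
proof (induction k)
  case 0
  then show ?case using distr_id[of P] by (simp add: id_def)
next
  case (Suc k)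
  have "distr P P (shift_by (Suc k)) = distr (distr P P shift) P (shift_by k)"
    by (subst distr_distr) (auto simp: shift_conv_shift_by comp_def)
  also have "\<dots> = P"
    using stationary_ergodic_P Suc by (simp add: stationary_ergodic_def)
  finally show ?case .
qed

lemma integrable_shift_by:
  fixes f :: "(int \<Rightarrow> real) \<Rightarrow> real"
  assumes "integrable P f"
  shows "integrable P (\<lambda>x. f (shift_by k x))"
  using assms distr_shift_by[of k]
  by (metis borel_measurable_integrable integrable_distr measurable_shift_by)

lemma integral_shift_by:
  fixes f :: "(int \<Rightarrow> real) \<Rightarrow> real"
  assumes "integrable P f"
  shows "(\<integral>x. f (shift_by k x) \<partial>P) = (\<integral>x. f x \<partial>P)"
  using integral_distr[of "shift_by k" P P f] assms distr_shift_by[of k] by auto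

lemma prob_shift_by:
  assumes "A \<in> events"
  shows "prob (shift_by k -` A) = prob A"
  using measure_distr[of "shift_by k" P P A] assms distr_shift_by[of k] by simp

lemma AE_shift_by:
  assumes "AE x in P. Q x"
  shows "AE x in P. Q (shift_by k x)"
  by (rule AE_distrD[OF measurable_shift_by[of k]]) (unfold distr_shift_by, rule assms)

lemma invariant_event_trivial:
  assumes "A \<in> events" "\<And>x. shift x \<in> A \<longleftrightarrow> x \<in> A"
  shows "prob A = 0 \<or> prob A = 1"
proof -
  have "emeasure P A = 0 \<or> emeasure P A = 1"
    using stationary_ergodic_P assms unfolding stationary_ergodic_def by (auto simp: vimage_def)
  then show ?thesis
    by (auto simp: measure_def)
qed

text \<open>Stationarity gives every tail event \<open>C n\<close> (a visit to \<open>B\<close> at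
  some time at least \<open>n\<close>) probability at least that of \<open>B\<close>. The
  intersection of these events is strictly invariant, as \<open>invariant_event_trivial\<close>
  requires, whereas \<open>C 0\<close> alone is invariant only up to a null set.\<close>

lemma recurrence:
  assumes [measurable]: "B \<in> events" and pos: "prob B > 0"
  shows "AE x in P. \<exists>k. shift_by k x \<in> B"
proof -
  define C where "C n = (\<Union>k\<in>{n..}. shift_by k -` B)" for n
  have vB: "shift_by k -` B \<in> events" for k
    using measurable_sets[OF measurable_shift_by[of k] assms(1)] by simp
  have C [measurable]: "C n \<in> events" for n
    unfolding C_def by (rule sets.countable_UN'') (auto intro: vB)
  have dec: "decseq C"
    by (force simp: decseq_def C_def)
  have ge: "prob (C n) \<ge> prob B" for n
  proof -
    have "prob (shift_by n -` B) \<le> prob (C n)"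
      by (rule finite_measure_mono[OF _ C]) (auto simp: C_def)
    then show ?thesis
      using prob_shift_by[OF assms(1)] by simp
  qed
  have "(\<lambda>n. prob (C n)) \<longlonglongrightarrow> prob (\<Inter>n. C n)"
    by (rule finite_Lim_measure_decseq) (use dec C in auto)
  then have "prob (\<Inter>n. C n) \<ge> prob B"
    by (rule LIMSEQ_le_const) (use ge in auto)
  moreover have "prob (\<Inter>n. C n) = 0 \<or> prob (\<Inter>n. C n) = 1"
  proof (rule invariant_event_trivial)
    fix x
    have "shift x \<in> C n \<longleftrightarrow> x \<in> C (Suc n)" for n
      by (auto simp: C_def shift_by_Suc[symmetric])
         (metis Suc_le_D Suc_le_mono atLeast_iff shift_by_Suc)
    moreover have "x \<in> C (Suc n) \<Longrightarrow> x \<in> C n" for n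
      using decseqD[OF dec, of n "Suc n"] by auto
    moreover have "C (Suc 0) \<subseteq> C 0"
      using decseqD[OF dec, of 0 "Suc 0"] by auto
    ultimately show "shift x \<in> (\<Inter>n. C n) \<longleftrightarrow> x \<in> (\<Inter>n. C n)"
      by auto
  qed (use C in auto)
  ultimately have "prob (\<Inter>n. C n) = 1"
    using pos by linarith
  then have "AE x in P. x \<in> (\<Inter>n. C n)"
    by (subst (asm) prob_eq_1) auto
  then show ?thesis
    by eventually_elim (auto simp: C_def)
qed

lemma measurable_shift_by_comp [measurable (raw)]:
  assumes "f \<in> measurable P N"
  shows "(\<lambda>x. f (shift_by k x)) \<in> measurable P N"
  using measurable_compose[OF measurable_shift_by assms] .

text \<open>Garsia's argument: the running maxima \<open>m n\<close> of the partial sums satisfy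
  \<open>m (n+1) - m n \<circ> shift = max (- m n \<circ> shift) f\<close>, whose mean is nonnegative; where the partial sums
  are unbounded this increment converges to \<open>f\<close>.\<close>

lemma partial_sums_bounded_above:
  fixes f :: "(int \<Rightarrow> real) \<Rightarrow> real"
  assumes int: "integrable P f" and neg: "(\<integral>x. f x \<partial>P) < 0"
  shows "AE x in P. \<exists>C::nat. \<forall>n. (\<Sum>k<n. f (shift_by k x)) \<le> real C"
proof -
  have [measurable]: "f \<in> borel_measurable P" using int by auto
  define S where "S n x = (\<Sum>k<n. f (shift_by k x))" for n x
  have S0: "S 0 x = 0" for x by (simp add: S_def)
  have SSuc: "S (Suc n) x = f x + S n (shift x)" for n x
    unfolding S_def by (subst sum.lessThan_Suc_shift) (simp add: shift_by_Suc)
  have [measurable]: "S n \<in> borel_measurable P" for n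
    unfolding S_def by measurable
  define B where "B = {x. \<not> (\<exists>C::nat. \<forall>n. S n x \<le> real C)}"
  have "{x \<in> space P. \<not> (\<exists>C::nat. \<forall>n. S n x \<le> real C)} \<in> events"
    by measurable
  then have [measurable]: "B \<in> events" by (simp add: B_def)
  have inv: "shift x \<in> B \<longleftrightarrow> x \<in> B" for x
  proof
    assume a: "shift x \<in> B"
    show "x \<in> B"
      unfolding B_def
    proof (rule CollectI, rule notI, erule exE)
      fix C :: nat assume "\<forall>n. S n x \<le> real C"
      then have "f x + S n (shift x) \<le> real C" for n
        using SSuc[of n x] by metis
      then have "S n (shift x) \<le> real (nat \<lceil>real C - f x\<rceil>)" for n
        by (smt (verit) of_nat_ceiling)
      then show False using a unfolding B_def by blast
    qed
  next
    assume a: "x \<in> B"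
    show "shift x \<in> B"
      unfolding B_def
    proof (rule CollectI, rule notI, erule exE)
      fix C :: nat assume b: "\<forall>n. S n (shift x) \<le> real C"
      have "S n x \<le> real (nat \<lceil>max 0 (f x + real C)\<rceil>)" for n
      proof (cases n)
        case (Suc j)
        have "S n x \<le> max 0 (f x + real C)" using SSuc[of j x] b Suc by (smt (verit))
        then show ?thesis by linarith
      qed (simp add: S0)
      then show False using a unfolding B_def by blast
    qed
  qed
  have "prob B \<noteq> 1"
  proof
    assume 1: "prob B = 1"
    have aeB: "AE x in P. x \<in> B"
      using 1 by (subst (asm) prob_eq_1) auto
    \<comment> \<open>\<open>m n x\<close> is the maximum of \<open>S 0 x, ..., S n x\<close>,
      written as a recursion along the shift so that the increments in \<open>deq\<close> can be
      read off.\<close>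
    define m where "m = rec_nat (\<lambda>x::int\<Rightarrow>real. 0::real) (\<lambda>n g x. max 0 (f x + g (shift x)))"
    have m0: "m 0 x = 0" and mS: "m (Suc n) x = max 0 (f x + m n (shift x))" for n x
      by (simp_all add: m_def)
    have mpos: "m n x \<ge> 0" for n x by (cases n) (auto simp: m0 mS)
    have mint: "integrable P (m n)" for n
    proof (induction n)
      case 0
      have "m 0 = (\<lambda>x. 0)" by (auto simp: m0)
      then show ?case by simp
    next
      case (Suc n)
      have "integrable P (\<lambda>x. max 0 (f x + m n (shift_by 1 x)))"
        using integrable_shift_by[OF Suc, of 1] int by (intro integrable_max) auto
      moreover have "m (Suc n) = (\<lambda>x. max 0 (f x + m n (shift_by 1 x)))"
        by (auto simp: mS shift_conv_shift_by)
      ultimately show ?case by simp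
    qed
    have mmono1: "m n x \<le> m (Suc n) x" for n x
    proof (induction n arbitrary: x)
      case 0 then show ?case by (simp add: m0 mS)
    next
      case (Suc n)
      have "m (Suc n) x = max 0 (f x + m n (shift x))" by (rule mS)
      also have "\<dots> \<le> max 0 (f x + m (Suc n) (shift x))" using Suc[of "shift x"] by linarith
      also have "\<dots> = m (Suc (Suc n)) x" by (rule mS[symmetric])
      finally show ?case .
    qed
    have mmono: "m i x \<le> m j x" if "i \<le> j" for i j x
      using lift_Suc_mono_le[of "\<lambda>n. m n x", OF mmono1 that] .
    have mge: "S n x \<le> m n x" for n x
    proof (induction n arbitrary: x)
      case 0 then show ?case by (simp add: m0 S0)
    next
      case (Suc n)
      show ?case using Suc[of "shift x"] SSuc[of n x] mS[of n x] by linarith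
    qed
    define d where "d n x = m (Suc n) x - m n (shift_by 1 x)" for n x
    have dint: "integrable P (d n)" for n
      unfolding d_def using integrable_shift_by[OF mint, of n 1] mint[of "Suc n"] by auto
    have dge: "(\<integral>x. d n x \<partial>P) \<ge> 0" for n
    proof -
      have "(\<integral>x. d n x \<partial>P) = (\<integral>x. m (Suc n) x \<partial>P) - (\<integral>x. m n x \<partial>P)"
        unfolding d_def using integrable_shift_by[OF mint, of n 1] mint[of "Suc n"] integral_shift_by[OF mint, of n 1]
        by simp
      moreover have "(\<integral>x. m n x \<partial>P) \<le> (\<integral>x. m (Suc n) x \<partial>P)"
        by (rule integral_mono) (use mint mmono1 in auto)
      ultimately show ?thesis by linarith
    qed
    have deq: "d n x = max (- m n (shift x)) (f x)" for n x
      unfolding d_def by (simp add: mS shift_conv_shift_by)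
    have lim: "AE x in P. (\<lambda>n. d n x) \<longlonglongrightarrow> f x"
      using aeB
    proof eventually_elim
      case (elim x)
      then have "shift x \<in> B" using inv by blast
      then have "\<not> (\<forall>n. S n (shift x) \<le> real (nat \<lceil>\<bar>f x\<bar>\<rceil>))" unfolding B_def by blast
      then obtain n0 where "S n0 (shift x) > \<bar>f x\<bar>" by (smt (verit) of_nat_ceiling)
      then have "m n0 (shift x) > \<bar>f x\<bar>" using mge[of n0 "shift x"] by linarith
      then have "d n x = f x" if "n \<ge> n0" for n
        using mmono[OF that, of "shift x"] deq[of n x] by linarith
      then have "eventually (\<lambda>n. d n x = f x) sequentially"
        using eventually_sequentially by blast
      then show ?case by (rule tendsto_eventually)
    qed
    have "(\<lambda>n. \<integral>x. d n x \<partial>P) \<longlonglongrightarrow> (\<integral>x. f x \<partial>P)"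
    proof (rule integral_dominated_convergence[where w="\<lambda>x. \<bar>f x\<bar>"])
      \<comment> \<open>Since \<open>m n\<close> is nonnegative,
        \<open>max (- m n (shift x)) (f x)\<close> either equals \<open>f x\<close> or lies between
        \<open>f x\<close> and 0.\<close>
      fix n show "AE x in P. norm (d n x) \<le> \<bar>f x\<bar>"
        using mpos by (intro AE_I2) (auto simp: deq max_def abs_if; smt (verit))
    qed (use lim dint int in auto)
    then have "(\<integral>x. f x \<partial>P) \<ge> 0"
      by (rule LIMSEQ_le_const) (use dge in auto)
    then show False using neg by linarith
  qed
  then have "prob B = 0" using invariant_event_trivial[of B] inv by auto
  then have "AE x in P. x \<notin> B"
    using AE_iff_measurable[of B P "\<lambda>x. x \<notin> B"] by (auto simp: emeasure_eq_measure)
  then show ?thesis by eventually_elim (auto simp: B_def S_def)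
qed

text \<open>Boundedness of the partial sums is applied to \<open>f\<close> minus its mean minus
  \<open>1 / Suc j\<close>, a function of negative mean; a second \<open>1 / Suc j\<close> absorbs
  the bound \<open>C\<close> after division by \<open>n\<close>. Only countably many margins occur,
  so one null set serves them all.\<close>

lemma birkhoff_upper:
  fixes f :: "(int \<Rightarrow> real) \<Rightarrow> real"
  assumes int: "integrable P f"
  shows "AE x in P. \<forall>j. \<forall>\<^sub>F n in sequentially.
    (\<Sum>k<n. f (shift_by k x)) / real n \<le> (\<integral>x. f x \<partial>P) + 2 / real (Suc j)"
proof (subst AE_all_countable, rule allI)
  fix j
  let ?e = "(\<integral>x. f x \<partial>P) + 1 / real (Suc j)"
  have "AE x in P. \<exists>C::nat. \<forall>n. (\<Sum>k<n. f (shift_by k x) - ?e) \<le> real C"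
    by (rule partial_sums_bounded_above) (use int prob_space in auto)
  then show "AE x in P. \<forall>\<^sub>F n in sequentially.
    (\<Sum>k<n. f (shift_by k x)) / real n \<le> (\<integral>x. f x \<partial>P) + 2 / real (Suc j)"
  proof eventually_elim
    case (elim x)
    then obtain C :: nat where C: "\<And>n. (\<Sum>k<n. f (shift_by k x) - ?e) \<le> real C" by auto
    show ?case
      unfolding eventually_sequentially
    proof (intro exI allI impI)
      fix n assume n: "Suc (C * Suc j) \<le> n"
      have "real C * real (Suc j) \<le> real n"
        using n by (metis Suc_leD of_nat_le_iff of_nat_mult)
      then have "real C \<le> real n * (1 / real (Suc j))"
        by (simp add: field_simps)
      moreover have "(\<Sum>k<n. f (shift_by k x)) - real n * ?e \<le> real C"
        using C[of n] by (simp add: sum_subtractf)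
      ultimately have "(\<Sum>k<n. f (shift_by k x)) \<le> real n * (?e + 1 / real (Suc j))"
        unfolding distrib_left by linarith
      moreover have "?e + 1 / real (Suc j) = (\<integral>x. f x \<partial>P) + 2 / real (Suc j)"
        by (simp add: field_simps)
      moreover have "real n > 0" using n by linarith
      ultimately show "(\<Sum>k<n. f (shift_by k x)) / real n \<le> (\<integral>x. f x \<partial>P) + 2 / real (Suc j)"
        by (simp add: pos_divide_le_eq mult.commute add.commute)
    qed
  qed
qed

lemma birkhoff:
  fixes f :: "(int \<Rightarrow> real) \<Rightarrow> real"
  assumes int: "integrable P f"
  shows "AE x in P. (\<lambda>n. (\<Sum>k<n. f (shift_by k x)) / real n) \<longlonglongrightarrow> (\<integral>x. f x \<partial>P)"
proof -
  have "integrable P (\<lambda>x. - f x)" using int by simp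
  from birkhoff_upper[OF int] birkhoff_upper[OF this] show ?thesis
  proof eventually_elim
    case (elim x)
    show ?case
    proof (rule LIMSEQ_I)
      fix r :: real assume "r > 0"
      then obtain j where "inverse (real (Suc j)) < r / 2" using reals_Archimedean[of "r/2"] by auto
      then have j: "2 / real (Suc j) < r" by (simp add: field_simps)
      have "\<forall>\<^sub>F n in sequentially. norm ((\<Sum>k<n. f (shift_by k x)) / real n - (\<integral>x. f x \<partial>P)) < r"
        using elim(1)[rule_format, of j] elim(2)[rule_format, of j]
        by eventually_elim (use j in \<open>simp add: sum_negf; linarith\<close>)
      then show "\<exists>no. \<forall>n\<ge>no. norm ((\<Sum>k<n. f (shift_by k x)) / real n - (\<integral>x. f x \<partial>P)) < r"
        by (simp add: eventually_sequentially)
    qed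
  qed
qed

end

section \<open>Sub-probability densities and block mixtures\<close>

text \<open>Block functions live on whole sequences instead of finite products, so that they can be
  composed with shifts and multiplied without changes of space; measurability is stated
  separately.\<close>

definition depends_on_block :: "nat \<Rightarrow> ((int \<Rightarrow> real) \<Rightarrow> 'b) \<Rightarrow> bool" where
  "depends_on_block n F \<longleftrightarrow> (\<forall>x y. (\<forall>i\<in>{1..int n}. x i = y i) \<longrightarrow> F x = F y)"

text \<open>A measurable section of the restriction map: it turns a function of a block into a
  function on the finite product space.\<close>

definition extend_zero :: "int set \<Rightarrow> (int \<Rightarrow> real) \<Rightarrow> int \<Rightarrow> real" where
  "extend_zero A x = (\<lambda>i. if i \<in> A then x i else 0)"

lemma measurable_extend_zero:
  "extend_zero A \<in> measurable (\<Pi>\<^sub>M i\<in>A. borel) (\<Pi>\<^sub>M i\<in>UNIV. borel)"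
proof (rule measurable_PiM_single')
  fix i :: int
  show "(\<lambda>x. extend_zero A x i) \<in> (\<Pi>\<^sub>M i\<in>A. borel) \<rightarrow>\<^sub>M borel"
    by (cases "i \<in> A") (auto simp: extend_zero_def)
qed (auto simp: space_PiM PiE_UNIV_domain)

lemma depends_on_block_extend_zero:
  "depends_on_block n F \<Longrightarrow> F (extend_zero {1..int n} (restrict x {1..int n})) = F x"
  unfolding depends_on_block_def extend_zero_def by auto

lemma depends_on_block_const: "depends_on_block n (\<lambda>x. c)"
  by (auto simp: depends_on_block_def)

lemma depends_on_block_comp: "depends_on_block n F \<Longrightarrow> depends_on_block n (\<lambda>x. g (F x))"
  unfolding depends_on_block_def by metis

lemma depends_on_block_comp2:
  "depends_on_block n F \<Longrightarrow> depends_on_block n G \<Longrightarrow> depends_on_block n (\<lambda>x. g (F x) (G x))"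
  unfolding depends_on_block_def by metis

lemma depends_on_block_mono: "depends_on_block n F \<Longrightarrow> n \<le> m \<Longrightarrow> depends_on_block m F"
  unfolding depends_on_block_def by (metis atLeastAtMost_iff of_nat_le_iff order_trans)

lemma depends_on_block_sum:
  "(\<And>i. i \<in> I \<Longrightarrow> depends_on_block n (F i)) \<Longrightarrow> depends_on_block n (\<lambda>x. \<Sum>i\<in>I. F i x)"
  unfolding depends_on_block_def by (auto intro!: sum.cong)

lemma depends_on_block_shift_by:
  assumes "depends_on_block n F"
  shows "depends_on_block (k + n) (\<lambda>x. F (shift_by k x))"
  unfolding depends_on_block_def
proof (intro allI impI)
  fix x y :: "int \<Rightarrow> real" assume "\<forall>i\<in>{1..int (k + n)}. x i = y i"
  then have "\<forall>i\<in>{1..int n}. shift_by k x i = shift_by k y i"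
    by (auto simp: shift_by_def)
  with assms show "F (shift_by k x) = F (shift_by k y)"
    unfolding depends_on_block_def by blast
qed

lemma npd_weight_eq: "npd_weight l = 1 / ((real l + 1) * (real l + 2))"
  by (simp add: npd_weight_def field_simps)

lemma npd_weight_pos: "npd_weight l > 0"
  unfolding npd_weight_eq by (intro divide_pos_pos mult_pos_pos) auto

lemma npd_weight_sums: "npd_weight sums 1"
proof -
  have "(\<lambda>n. 1 / (real n + 1)) \<longlonglongrightarrow> 0"
    using LIMSEQ_inverse_real_of_nat by (simp add: inverse_eq_divide add.commute)
  from telescope_sums'[OF this] show ?thesis
    by (simp add: npd_weight_def[abs_def] add_ac)
qed

lemma sum_npd_weight_le: "(\<Sum>j\<le>N. npd_weight j) \<le> 1"
  using sum_le_suminf[of npd_weight "{..N}"] npd_weight_sums npd_weight_pos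
  by (metis finite_atMost less_imp_le sums_iff)

section \<open>The product reference measure and the independence of its blocks\<close>

locale dominating_product =
  fixes \<mu> :: "real measure"
  assumes prob_space_mu: "prob_space \<mu>" and sets_mu [measurable_cong]: "sets \<mu> = sets borel"
begin

definition M :: "(int \<Rightarrow> real) measure" where "M = (\<Pi>\<^sub>M i\<in>UNIV. \<mu>)"

lemma sets_M [measurable_cong]: "sets M = sets (\<Pi>\<^sub>M i\<in>UNIV. borel)"
  unfolding M_def by (intro sets_PiM_cong) (auto simp: sets_mu)

lemma space_M [simp]: "space M = UNIV"
  using sets_eq_imp_space_eq[OF sets_M] by (simp add: space_PiM PiE_UNIV_domain)

sublocale product: product_prob_space "\<lambda>_::int. \<mu>" UNIV
  by (rule product_prob_spaceI) (rule prob_space_mu)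

sublocale M: prob_space M
  unfolding M_def by (rule prob_space_PiM) (rule prob_space_mu)

lemma nn_integral_shift_by_M:
  assumes [measurable]: "v \<in> borel_measurable (\<Pi>\<^sub>M i\<in>UNIV. borel)"
  shows "(\<integral>\<^sup>+x. v (shift_by n x) \<partial>M) = (\<integral>\<^sup>+x. v x \<partial>M)"
proof -
  have "distr (\<Pi>\<^sub>M i\<in>UNIV. \<mu>) (\<Pi>\<^sub>M i\<in>(UNIV::int set). \<mu>) (\<lambda>\<omega>. \<lambda>i\<in>UNIV. \<omega> (i + int n)) = (\<Pi>\<^sub>M i\<in>UNIV. \<mu>)"
    using distr_PiM_reindex[of UNIV "\<lambda>_. \<mu>" "\<lambda>i. i + int n" UNIV] prob_space_mu
    by (auto simp: inj_on_def)
  then have "distr M M (shift_by n) = M"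
    by (simp add: M_def shift_by_def[abs_def] restrict_def)
  moreover have "(\<integral>\<^sup>+x. v x \<partial>distr M M (shift_by n)) = (\<integral>\<^sup>+x. v (shift_by n x) \<partial>M)"
    by (rule nn_integral_distr) measurable
  ultimately show ?thesis by simp
qed

lemma indep_vars_coordinates: "M.indep_vars (\<lambda>_. borel) (\<lambda>i x. x i) (UNIV :: int set)"
proof (subst M.indep_vars_iff_distr_eq_PiM)
  have "distr M (\<Pi>\<^sub>M i\<in>UNIV. borel) (\<lambda>x. \<lambda>i\<in>UNIV. x i) = distr M M id"
    by (intro distr_cong) (auto simp: sets_M)
  also have "\<dots> = M" by (simp add: id_def)
  also have "M = (\<Pi>\<^sub>M i\<in>UNIV. distr M borel (\<lambda>x. x i))"
  proof -
    have "distr M borel (\<lambda>x. x i) = distr M \<mu> (\<lambda>x. x i)" for i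
      by (intro distr_cong) (auto simp: sets_mu)
    then have "distr M borel (\<lambda>x. x i) = \<mu>" for i
      using distr_PiM_component[of UNIV "\<lambda>_. \<mu>" i] prob_space_mu by (simp add: M_def)
    then show ?thesis by (simp add: M_def)
  qed
  finally show "distr M (\<Pi>\<^sub>M i\<in>UNIV. borel) (\<lambda>x. \<lambda>i\<in>UNIV. x i) = (\<Pi>\<^sub>M i\<in>UNIV. distr M borel (\<lambda>x. x i))" .
qed auto

text \<open>Under \<open>M\<close> the coordinates up to \<open>n\<close> are independent of those
  beyond \<open>n\<close>; \<open>u\<close> sees only the former, and \<open>v\<close> after the
  shift only the latter.\<close>

lemma nn_integral_block_mult:
  fixes u v :: "(int \<Rightarrow> real) \<Rightarrow> ennreal"
  assumes [measurable]: "u \<in> borel_measurable (\<Pi>\<^sub>M i\<in>UNIV. borel)" "v \<in> borel_measurable (\<Pi>\<^sub>M i\<in>UNIV. borel)"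
    and u: "depends_on_block n u" and v: "depends_on_block m v"
  shows "(\<integral>\<^sup>+x. u x * v (shift_by n x) \<partial>M) = (\<integral>\<^sup>+x. u x \<partial>M) * (\<integral>\<^sup>+x. v x \<partial>M)"
proof -
  let ?A = "{1..int n}" and ?B = "{int n + 1..}"
  let ?u = "u \<circ> extend_zero ?A" and ?v = "(\<lambda>x. v (shift_by n x)) \<circ> extend_zero ?B"
  have "M.indep_var (PiM ?A (\<lambda>_. borel)) (\<lambda>x. restrict (\<lambda>i. x i) ?A) (PiM ?B (\<lambda>_. borel)) (\<lambda>x. restrict (\<lambda>i. x i) ?B)"
    by (rule M.indep_var_restrict[OF indep_vars_coordinates]) auto
  then have "M.indep_var borel (?u \<circ> (\<lambda>x. restrict x ?A)) borel (?v \<circ> (\<lambda>x. restrict x ?B))"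
    by (rule M.indep_var_compose)
       (auto intro!: measurable_comp[OF measurable_extend_zero] simp del: o_apply)
  moreover have "?u \<circ> (\<lambda>x. restrict x ?A) = u"
    using depends_on_block_extend_zero[OF u] by auto
  moreover have "?v \<circ> (\<lambda>x. restrict x ?B) = (\<lambda>x. v (shift_by n x))"
  proof
    fix x
    have "\<forall>i\<in>{1..int m}. shift_by n (extend_zero ?B (restrict x ?B)) i = shift_by n x i"
      by (auto simp: shift_by_def extend_zero_def)
    then show "(?v \<circ> (\<lambda>x. restrict x ?B)) x = v (shift_by n x)"
      using v unfolding depends_on_block_def by auto
  qed
  ultimately have ind: "M.indep_var borel u borel (\<lambda>x. v (shift_by n x))" by simp
  have "(\<integral>\<^sup>+x. (\<Prod>b\<in>UNIV. (case_bool u (\<lambda>x. v (shift_by n x)) b) x) \<partial>M)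
     = (\<Prod>b\<in>UNIV. (\<integral>\<^sup>+x. (case_bool u (\<lambda>x. v (shift_by n x)) b) x \<partial>M))"
  proof (rule M.indep_vars_nn_integral)
    have "case_bool borel borel = (\<lambda>_. borel :: ennreal measure)" by (auto split: bool.split)
    then show "M.indep_vars (\<lambda>_. borel) (case_bool u (\<lambda>x. v (shift_by n x))) UNIV"
      using ind unfolding M.indep_var_def by simp
  qed auto
  then have "(\<integral>\<^sup>+x. v (shift_by n x) * u x \<partial>M) = (\<integral>\<^sup>+x. v (shift_by n x) \<partial>M) * (\<integral>\<^sup>+x. u x \<partial>M)"
    by (simp add: UNIV_bool)
  then show ?thesis
    unfolding nn_integral_shift_by_M[OF assms(2)] by (simp only: mult.commute)
qed

end

text \<open>Scan a word from left to right, spending at each step either the factor \<open>1/2\<close> on a single letter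
  or the factor \<open>npd_weight j / 2\<close> on a block of length \<open>j + 1\<close>, which is then coded by \<open>u (j + 1)\<close>.\<close>

fun block_mixture :: "(nat \<Rightarrow> (int \<Rightarrow> real) \<Rightarrow> real) \<Rightarrow> nat \<Rightarrow> (int \<Rightarrow> real) \<Rightarrow> real" where
  "block_mixture u 0 x = 1"
| "block_mixture u (Suc N) x = block_mixture u N (shift_by 1 x) / 2 +
     (\<Sum>j\<le>N. npd_weight j / 2 * (u (Suc j) x * block_mixture u (N - j) (shift_by (Suc j) x)))"

section \<open>Block mixtures are sub-probability densities and dominate every tiling\<close>

locale sub_density = dominating_product +
  fixes u :: "nat \<Rightarrow> (int \<Rightarrow> real) \<Rightarrow> real"
  assumes u_nonneg: "u n x \<ge> 0"
    and u_measurable [measurable]: "u n \<in> borel_measurable (\<Pi>\<^sub>M i\<in>UNIV. borel)"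
    and u_block: "depends_on_block n (u n)"
    and u_integral: "(\<integral>\<^sup>+x. ennreal (u n x) \<partial>M) \<le> 1"
begin

lemma block_mixture_nonneg: "block_mixture u N x \<ge> 0"
proof (induction N arbitrary: x rule: less_induct)
  case (less N)
  show ?case
    by (cases N) (auto intro!: add_nonneg_nonneg sum_nonneg mult_nonneg_nonneg less
        simp: u_nonneg less_imp_le[OF npd_weight_pos])
qed

lemma block_mixture_measurable [measurable]: "block_mixture u N \<in> borel_measurable (\<Pi>\<^sub>M i\<in>UNIV. borel)"
proof (induction N rule: less_induct)
  case (less N)
  show ?case
  proof (cases N)
    case (Suc n)
    have [measurable]: "block_mixture u n \<in> borel_measurable (\<Pi>\<^sub>M i\<in>UNIV. borel)"
      "block_mixture u (n - j) \<in> borel_measurable (\<Pi>\<^sub>M i\<in>UNIV. borel)" for j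
      using less Suc by auto
    show ?thesis
      unfolding Suc block_mixture.simps by measurable
  qed simp
qed

lemma block_mixture_block: "depends_on_block N (block_mixture u N)"
proof (induction N rule: less_induct)
  case (less N)
  show ?case
  proof (cases N)
    case (Suc n)
    have "depends_on_block (Suc n) (\<lambda>x. u (Suc j) x * block_mixture u (n - j) (shift_by (Suc j) x))"
      if "j \<le> n" for j
    proof (rule depends_on_block_comp2[where g="(*)"])
      show "depends_on_block (Suc n) (\<lambda>x. block_mixture u (n - j) (shift_by (Suc j) x))"
        using depends_on_block_shift_by[of "n - j" "block_mixture u (n - j)" "Suc j"] less[of "n - j"] Suc that by simp
    qed (rule depends_on_block_mono[OF u_block], use that in simp)
    moreover have "depends_on_block (Suc n) (\<lambda>x. block_mixture u n (shift_by 1 x))"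
      using depends_on_block_shift_by[of n "block_mixture u n" 1] less[of n] Suc by simp
    ultimately show ?thesis
      unfolding Suc block_mixture.simps
      by (intro depends_on_block_comp2[where g="(+)"] depends_on_block_sum depends_on_block_comp[where g="\<lambda>y. _ * y"]
          depends_on_block_comp[where g="\<lambda>y. y / 2"]) auto
  qed (simp add: depends_on_block_const)
qed

text \<open>In each summand the leading block and the remaining mixture use disjoint coordinates, so
  the integral factors and is at most the weight of the summand. The weights add up to at most
  \<open>1/2 + 1/2\<close>.\<close>

lemma block_mixture_integral: "(\<integral>\<^sup>+x. ennreal (block_mixture u N x) \<partial>M) \<le> 1"
proof (induction N rule: less_induct)
  case (less N)
  show ?case
  proof (cases N)
    case 0
    then show ?thesis using M.emeasure_space_1 by simp
  next
    case (Suc n)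
    let ?b = "block_mixture u"
    have 1: "(\<integral>\<^sup>+x. ennreal (?b n (shift_by 1 x)) \<partial>M) \<le> 1"
      using nn_integral_shift_by_M[of "\<lambda>x. ennreal (?b n x)" 1] less[of n] Suc by simp
    have 2: "(\<integral>\<^sup>+x. ennreal (u (Suc j) x) * ennreal (?b (n - j) (shift_by (Suc j) x)) \<partial>M) \<le> 1" if "j \<le> n" for j
    proof -
      have "(\<integral>\<^sup>+x. ennreal (u (Suc j) x) * ennreal (?b (n - j) (shift_by (Suc j) x)) \<partial>M)
         = (\<integral>\<^sup>+x. ennreal (u (Suc j) x) \<partial>M) * (\<integral>\<^sup>+x. ennreal (?b (n - j) x) \<partial>M)"
        by (rule nn_integral_block_mult[where m="n - j"])
           (auto intro: depends_on_block_comp u_block block_mixture_block)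
      also have "\<dots> \<le> 1 * 1"
        using u_integral[of "Suc j"] less[of "n - j"] Suc by (intro mult_mono) auto
      finally show ?thesis by simp
    qed
    have "(\<integral>\<^sup>+x. ennreal (?b N x) \<partial>M) =
      (\<integral>\<^sup>+x. ennreal (1/2) * ennreal (?b n (shift_by 1 x)) + (\<Sum>j\<le>n. ennreal (npd_weight j / 2) *
          (ennreal (u (Suc j) x) * ennreal (?b (n - j) (shift_by (Suc j) x)))) \<partial>M)"
    proof (rule nn_integral_cong)
      fix x
      have half: "0 \<le> (1/2 :: real)" "0 \<le> npd_weight j / 2" for j
        by (simp_all add: less_imp_le[OF npd_weight_pos])
      have "ennreal (?b N x) = ennreal (1/2 * ?b n (shift_by 1 x)) +
          ennreal (\<Sum>j\<le>n. npd_weight j / 2 * (u (Suc j) x * ?b (n - j) (shift_by (Suc j) x)))"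
        unfolding Suc block_mixture.simps
        by (subst ennreal_plus[symmetric])
           (auto intro!: sum_nonneg mult_nonneg_nonneg
             simp: block_mixture_nonneg u_nonneg less_imp_le[OF npd_weight_pos])
      also have "\<dots> = ennreal (1/2 * ?b n (shift_by 1 x)) +
          (\<Sum>j\<le>n. ennreal (npd_weight j / 2 * (u (Suc j) x * ?b (n - j) (shift_by (Suc j) x))))"
        by (subst sum_ennreal)
           (auto intro!: mult_nonneg_nonneg
             simp: block_mixture_nonneg u_nonneg less_imp_le[OF npd_weight_pos])
      also have "\<dots> = ennreal (1/2) * ennreal (?b n (shift_by 1 x)) + (\<Sum>j\<le>n. ennreal (npd_weight j / 2) *
          (ennreal (u (Suc j) x) * ennreal (?b (n - j) (shift_by (Suc j) x))))"
        by (simp only: ennreal_mult block_mixture_nonneg u_nonneg less_imp_le[OF npd_weight_pos]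
            mult_nonneg_nonneg half)
      finally show "ennreal (?b N x) = \<dots>" .
    qed
    also have "\<dots> = ennreal (1/2) * (\<integral>\<^sup>+x. ennreal (?b n (shift_by 1 x)) \<partial>M) +
       (\<Sum>j\<le>n. ennreal (npd_weight j / 2) * (\<integral>\<^sup>+x. ennreal (u (Suc j) x) * ennreal (?b (n - j) (shift_by (Suc j) x)) \<partial>M))"
      by (simp add: nn_integral_add nn_integral_sum nn_integral_cmult)
    also have "\<dots> \<le> ennreal (1/2) * 1 + (\<Sum>j\<le>n. ennreal (npd_weight j / 2) * 1)"
      by (intro add_mono mult_left_mono sum_mono 1 2) auto
    also have "\<dots> = ennreal (1/2 + (\<Sum>j\<le>n. npd_weight j) / 2)"
      by (subst ennreal_plus)
         (auto intro!: sum_nonneg simp: less_imp_le[OF npd_weight_pos] sum_ennreal sum_divide_distrib)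
    also have "\<dots> \<le> 1"
      using sum_npd_weight_le[of n] by (simp add: ennreal_le_1)
    finally show ?thesis .
  qed
qed

lemma block_mixture_singles: "block_mixture u (k + N) x \<ge> (1/2) ^ k * block_mixture u N (shift_by k x)"
proof (induction k arbitrary: x)
  case (Suc k)
  have "(1/2) ^ Suc k * block_mixture u N (shift_by (Suc k) x) \<le> block_mixture u (k + N) (shift_by 1 x) / 2"
    using Suc[of "shift_by 1 x"] by simp
  also have "\<dots> \<le> block_mixture u (Suc k + N) x"
    by (auto intro!: sum_nonneg mult_nonneg_nonneg
        simp: u_nonneg less_imp_le[OF npd_weight_pos] block_mixture_nonneg)
  finally show ?case .
qed simp

text \<open>As for single letters, all branches of the recursion are nonnegative, and keeping one of
  them gives a lower bound.\<close>

lemma block_mixture_step: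
  "block_mixture u (Suc j + N) x \<ge> npd_weight j / 2 * u (Suc j) x * block_mixture u N (shift_by (Suc j) x)"
proof -
  have "npd_weight j / 2 * (u (Suc j) x * block_mixture u (j + N - j) (shift_by (Suc j) x)) \<le>
     (\<Sum>i\<le>j + N. npd_weight i / 2 * (u (Suc i) x * block_mixture u (j + N - i) (shift_by (Suc i) x)))"
    by (rule member_le_sum[where f="\<lambda>i. npd_weight i / 2 * (u (Suc i) x * block_mixture u (j + N - i) (shift_by (Suc i) x))"])
       (auto intro!: mult_nonneg_nonneg
        simp: u_nonneg less_imp_le[OF npd_weight_pos] block_mixture_nonneg)
  then show ?thesis
    using block_mixture_nonneg[of "j + N" "shift_by 1 x"] by (simp add: mult.assoc)
qed

text \<open>A position is good if a wait of \<open>k\<close> single letters followed by one block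
  reaches rate \<open>c\<close> over all \<open>k + Suc j\<close> letters, the price of the wait and
  the weight of the block included. The wait is part of the definition because recurrence provides a
  large block only after some delay; \<open>K\<close> bounds the delay and the block
  together.\<close>

definition good :: "real \<Rightarrow> nat \<Rightarrow> (int \<Rightarrow> real) set" where
  "good c K = {x. \<exists>k j. k + Suc j \<le> K \<and>
     2 powr (c * real (k + Suc j)) \<le> (1/2) ^ k * (npd_weight j / 2 * u (Suc j) (shift_by k x))}"

lemma good_measurable [measurable]: "good c K \<in> sets (\<Pi>\<^sub>M i\<in>UNIV. borel)"
proof -
  have "{x \<in> space (\<Pi>\<^sub>M i\<in>(UNIV :: int set). borel). \<exists>k j. k + Suc j \<le> K \<and>
     2 powr (c * real (k + Suc j)) \<le> (1/2) ^ k * (npd_weight j / 2 * u (Suc j) (shift_by k x))}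
      \<in> sets (\<Pi>\<^sub>M i\<in>UNIV. borel)"
    by measurable
  then show ?thesis by (simp add: good_def space_PiM PiE_UNIV_domain)
qed

text \<open>Greedy tiling from the left: at a good position a wait and a block of together at most
  \<open>K\<close> letters are coded at rate \<open>c\<close>, at a bad one a single letter is
  spent. A single letter costs one bit and forgoes \<open>c\<close>, hence the factor
  \<open>c + 1\<close>; the constant \<open>K\<close> pays for the fewer than \<open>K\<close> last
  letters, where a block need not fit.\<close>

lemma block_mixture_lower_bound:
  assumes c: "c \<ge> 0"
  shows "block_mixture u N x \<ge>
    2 powr (c * real N - (c + 1) * (real K + (\<Sum>i<N. indicator (- good c K) (shift_by i x))))"
proof (induction N arbitrary: x rule: less_induct)
  case (less N)
  define bad where "bad n x = (\<Sum>i<n. indicator (- good c K) (shift_by i x) :: real)" for n x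
  have bad_nonneg: "bad n x \<ge> 0" for n x by (auto simp: bad_def intro!: sum_nonneg)
  have bad_add: "bad (a + n) x = bad a x + bad n (shift_by a x)" for a n x
  proof -
    have "bad (a + n) x = bad a x + (\<Sum>i=a..<a+n. indicator (- good c K) (shift_by i x))"
      unfolding bad_def by (metis atLeast0LessThan le_add1 sum.atLeastLessThan_concat zero_le)
    also have "(\<Sum>i=a..<a+n. indicator (- good c K) (shift_by i x)) = bad n (shift_by a x)"
      unfolding bad_def using sum.shift_bounds_nat_ivl[of "\<lambda>i. indicator (- good c K) (shift_by i x) :: real" 0 a n]
      by (simp add: atLeast0LessThan add.commute)
    finally show ?thesis .
  qed
  have IH: "block_mixture u n x \<ge> 2 powr (c * real n - (c + 1) * (real K + bad n x))" if "n < N" for n x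
    using less[OF that] by (simp add: bad_def)
  have "2 powr (c * real N - (c + 1) * (real K + bad N x)) \<le> block_mixture u N x"
  \<comment> \<open>All \<open>N\<close> letters are spent singly. The alternative
    \<open>N = 0\<close> covers \<open>K = 0\<close>, where every position is bad and the other case
    needs a letter to consume.\<close>
  proof (cases "N < K \<or> N = 0")
    case True
    have "(1/2) ^ N * block_mixture u 0 (shift_by N x) \<le> block_mixture u N x"
      using block_mixture_singles[of N 0 x] by simp
    moreover have "(1/2) ^ N = 2 powr (- real N)"
      by (simp add: powr_minus powr_realpow power_one_over inverse_eq_divide)
    moreover have "c * real N - (c + 1) * (real K + bad N x) \<le> - real N"
    proof -
      have "(c + 1) * real N \<le> (c + 1) * (real K + bad N x)"
        using True bad_nonneg[of N x] c by (intro mult_left_mono) auto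
      then show ?thesis by (simp add: algebra_simps)
    qed
    ultimately show ?thesis
      by (smt (verit) block_mixture.simps(1) mult_cancel_left2 powr_mono)
  next
    case False
    show ?thesis
    proof (cases "x \<in> good c K")
      case True
      then obtain k j where kj: "k + Suc j \<le> K" and
        b: "2 powr (c * real (k + Suc j)) \<le> (1/2) ^ k * (npd_weight j / 2 * u (Suc j) (shift_by k x))"
        unfolding good_def by blast
      define n where "n = N - (k + Suc j)"
      have N: "N = k + (Suc j + n)" and n: "n < N" using kj False unfolding n_def by auto
      let ?y = "shift_by (k + Suc j) x"
      have "c * real N - (c + 1) * (real K + bad N x) \<le> c * real (k + Suc j) + (c * real n - (c + 1) * (real K + bad n ?y))"
      proof -
        \<comment> \<open>Bad positions inside the tile are dropped from the count, which can only
          raise the exponent for the rest.\<close>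
        have "bad N x = bad (k + Suc j) x + bad n ?y"
          using bad_add[of "k + Suc j" n x] N by (simp add: add.assoc)
        then have "bad n ?y \<le> bad N x" using bad_nonneg[of "k + Suc j" x] by linarith
        then have "(c + 1) * (real K + bad n ?y) \<le> (c + 1) * (real K + bad N x)"
          using c by (intro mult_left_mono) auto
        then show ?thesis unfolding N by (simp add: algebra_simps)
      qed
      then have "2 powr (c * real N - (c + 1) * (real K + bad N x)) \<le>
          2 powr (c * real (k + Suc j)) * 2 powr (c * real n - (c + 1) * (real K + bad n ?y))"
        by (simp add: powr_add[symmetric])
      also have "\<dots> \<le> ((1/2) ^ k * (npd_weight j / 2 * u (Suc j) (shift_by k x))) * block_mixture u n ?y"
        by (intro mult_mono b IH n) (auto intro!: mult_nonneg_nonneg simp: u_nonneg less_imp_le[OF npd_weight_pos])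
      also have "\<dots> = (1/2) ^ k * (npd_weight j / 2 * u (Suc j) (shift_by k x) * block_mixture u n (shift_by (Suc j) (shift_by k x)))"
        by (simp add: add_ac)
      also have "\<dots> \<le> (1/2) ^ k * block_mixture u (Suc j + n) (shift_by k x)"
        by (intro mult_left_mono block_mixture_step) auto
      also have "\<dots> \<le> block_mixture u N x"
        unfolding N by (rule block_mixture_singles)
      finally show ?thesis .
    next
      case bad: False
      obtain n where N: "N = Suc n" using False by (cases N) auto
      have "bad N x = 1 + bad n (shift_by 1 x)"
        using bad_add[of 1 n x] bad N by (simp add: bad_def)
      then have "c * real N - (c + 1) * (real K + bad N x) = -1 + (c * real n - (c + 1) * (real K + bad n (shift_by 1 x)))"
        by (simp add: N algebra_simps)
      then have "2 powr (c * real N - (c + 1) * (real K + bad N x)) = 1/2 * 2 powr (c * real n - (c + 1) * (real K + bad n (shift_by 1 x)))"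
        by (simp only: powr_add powr_minus) simp
      also have "\<dots> \<le> (1/2) ^ 1 * block_mixture u n (shift_by 1 x)"
        using IH[of n] N by simp
      also have "\<dots> \<le> block_mixture u N x"
        using block_mixture_singles[of 1 n x] N by simp
      finally show ?thesis .
    qed
  qed
  then show ?case by (simp add: bad_def)
qed

end

section \<open>The growth rate of sub-probability densities\<close>

text \<open>The rate \<open>D\<close> is not yet present: positivity of \<open>f n\<close> is needed
  first, to split the logarithm of a quotient of densities and so to establish integrability and the
  rate.\<close>

locale dominated_densities = stationary_process P + dominating_product \<mu>
  for P :: "(int \<Rightarrow> real) measure" and \<mu> :: "real measure" +
  fixes f :: "nat \<Rightarrow> (int \<Rightarrow> real) \<Rightarrow> real"
  assumes f_nonneg: "f n x \<ge> 0"
    and f_measurable [measurable]: "f n \<in> borel_measurable (\<Pi>\<^sub>M i\<in>UNIV. borel)"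
    and f_block: "depends_on_block n (f n)"
    and f_density: "F \<in> borel_measurable (\<Pi>\<^sub>M i\<in>UNIV. borel) \<Longrightarrow> depends_on_block n F \<Longrightarrow>
      (\<integral>\<^sup>+x. F x \<partial>P) = (\<integral>\<^sup>+x. F x * ennreal (f n x) \<partial>M)"
begin

lemma f_pos: "AE x in P. f n x > 0"
proof -
  have "(\<integral>\<^sup>+x. indicator {0} (f n x) \<partial>P) = (\<integral>\<^sup>+x. indicator {0} (f n x) * ennreal (f n x) \<partial>M)"
    by (rule f_density) (measurable, rule depends_on_block_comp[OF f_block])
  also have "\<dots> = (\<integral>\<^sup>+x. 0 \<partial>M)"
    by (intro nn_integral_cong) (auto split: split_indicator)
  finally have "(\<integral>\<^sup>+x. indicator {0} (f n x) \<partial>P) = (0 :: ennreal)"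
    by simp
  then have "AE x in P. indicator {0} (f n x) = (0 :: ennreal)"
    by (subst (asm) nn_integral_0_iff_AE) auto
  then show ?thesis
    by eventually_elim (use f_nonneg in \<open>auto simp: indicator_def less_le split: if_splits\<close>)
qed

end

section \<open>Gibbs' inequality and the upper bound on the growth rate\<close>

locale dominated_process = dominated_densities P \<mu> f
  for P :: "(int \<Rightarrow> real) measure" and \<mu> :: "real measure" and f :: "nat \<Rightarrow> (int \<Rightarrow> real) \<Rightarrow> real" +
  fixes D :: real
  assumes f_log_integrable: "integrable P (\<lambda>x. log 2 (f n x))"
    and f_rate: "(\<lambda>n. (\<integral>x. log 2 (f n x) \<partial>P) / real n) \<longlonglongrightarrow> D"
begin

text \<open>Gibbs' inequality: the quotient \<open>v / f n\<close> has \<open>P\<close>-mean at most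
  1, and \<open>log 2 y \<le> (y - 1) / ln 2\<close>. An integrable minorant \<open>L\<close>
  replaces \<open>log 2 v\<close>, whose integrability would have to be shown for each
  mixture.\<close>

lemma integral_log_f_ge:
  fixes v L :: "(int \<Rightarrow> real) \<Rightarrow> real"
  assumes v [measurable]: "v \<in> borel_measurable (\<Pi>\<^sub>M i\<in>UNIV. borel)" and v_nonneg: "\<And>x. v x \<ge> 0"
    and v_block: "depends_on_block n v" and v_int: "(\<integral>\<^sup>+x. ennreal (v x) \<partial>M) \<le> 1"
    and L: "integrable P L" "AE x in P. 2 powr L x \<le> v x"
  shows "(\<integral>x. L x \<partial>P) \<le> (\<integral>x. log 2 (f n x) \<partial>P)"
proof -
  let ?q = "\<lambda>x. v x / f n x"
  have "(\<integral>\<^sup>+x. ennreal (?q x) \<partial>P) = (\<integral>\<^sup>+x. ennreal (?q x) * ennreal (f n x) \<partial>M)"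
    by (rule f_density)
       (measurable, intro depends_on_block_comp[where g=ennreal] depends_on_block_comp2[where g="(/)"] v_block f_block)
  \<comment> \<open>Only an inequality: where \<open>f n\<close> vanishes the quotient is 0 by
    convention, whatever the value of \<open>v\<close>.\<close>
  also have "\<dots> \<le> (\<integral>\<^sup>+x. ennreal (v x) \<partial>M)"
    by (intro nn_integral_mono)
       (use v_nonneg f_nonneg in \<open>auto simp: ennreal_mult[symmetric] intro!: ennreal_leI\<close>)
  finally have q: "(\<integral>\<^sup>+x. ennreal (?q x) \<partial>P) \<le> 1"
    using v_int by (rule order_trans)
  have qi: "integrable P ?q"
    by (rule integrableI_nonneg)
       (use q f_nonneg v_nonneg in \<open>auto simp: order.strict_trans1[OF _ ennreal_one_less_top] intro!: divide_nonneg_nonneg\<close>)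
  have q1: "(\<integral>x. ?q x \<partial>P) \<le> 1"
    using q nn_integral_eq_integral[OF qi] f_nonneg v_nonneg by (auto simp: divide_nonneg_nonneg ennreal_le_1)
  have "(\<integral>x. L x - log 2 (f n x) \<partial>P) \<le> (\<integral>x. (?q x - 1) / ln 2 \<partial>P)"
  proof (rule integral_mono_AE)
    show "AE x in P. L x - log 2 (f n x) \<le> (?q x - 1) / ln 2"
      using L(2) f_pos[of n]
    proof eventually_elim
      case (elim x)
      have vpos: "v x > 0" using elim(1) by (smt (verit) powr_gt_zero)
      have "L x \<le> log 2 (v x)" using elim(1) vpos by (simp add: le_log_iff)
      moreover have "log 2 (v x) - log 2 (f n x) = log 2 (?q x)"
        using vpos elim(2) by (simp add: log_divide)
      moreover have "log 2 (?q x) \<le> (?q x - 1) / ln 2"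
        unfolding log_def using ln_le_minus_one[of "?q x"] vpos elim(2)
        by (intro divide_right_mono) auto
      ultimately show ?case by linarith
    qed
  qed (use L f_log_integrable qi in auto)
  also have "\<dots> = ((\<integral>x. ?q x \<partial>P) - 1) / ln 2"
    using qi prob_space by simp
  also have "\<dots> \<le> 0"
    using q1 by (simp add: divide_nonpos_pos)
  finally show ?thesis
    using L f_log_integrable[of n] by simp
qed

text \<open>Gibbs' inequality with the constant density 1. It guarantees that rates above
  \<open>D\<close> are nonnegative, as the tiling bound demands.\<close>

lemma D_nonneg: "D \<ge> 0"
proof -
  have "(\<integral>x. log 2 (f n x) \<partial>P) \<ge> 0" for n
    using integral_log_f_ge[of "\<lambda>x. 1" n "\<lambda>x. 0"] M.emeasure_space_1 by (simp add: depends_on_block_const)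
  then show ?thesis
    by (intro LIMSEQ_le_const[OF f_rate]) auto
qed

text \<open>The tiling bound is integrated: the number of bad positions among \<open>N\<close> has
  mean \<open>N\<close> times the bad probability, and Gibbs' inequality compares the mixture with
  \<open>f N\<close>. Division by \<open>N\<close> removes the constant \<open>K\<close>.\<close>

lemma sub_density_bad_prob:
  assumes "sub_density \<mu> u" and c: "c \<ge> 0"
  shows "c - (c + 1) * prob (- sub_density.good u c K) \<le> D"
proof -
  interpret sub_density \<mu> u by fact
  have [measurable]: "good c K \<in> events" by measurable
  have bad [measurable]: "- good c K \<in> events"
    using sets.compl_sets[of "good c K" P] by (simp add: Compl_eq_Diff_UNIV)
  let ?\<beta> = "prob (- good c K)"
  let ?S = "\<lambda>N x. \<Sum>i<N. indicator (- good c K) (shift_by i x) :: real"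
  have iint: "integrable P (indicator (- good c K) :: _ \<Rightarrow> real)"
    by (intro integrable_real_indicator bad) (simp add: less_top[symmetric])
  have Sint: "integrable P (?S N)" for N
    using integrable_shift_by[OF iint] by (intro Bochner_Integration.integrable_sum)
  have S: "(\<integral>x. ?S N x \<partial>P) = real N * ?\<beta>" for N
    using integrable_shift_by[OF iint] integral_shift_by[OF iint] by (simp add: Bochner_Integration.integral_sum)
  have "c * real N - (c + 1) * (real K + real N * ?\<beta>) \<le> (\<integral>x. log 2 (f N x) \<partial>P)" for N
  proof -
    have "(\<integral>x. c * real N - (c + 1) * (real K + ?S N x) \<partial>P) \<le> (\<integral>x. log 2 (f N x) \<partial>P)"
      by (rule integral_log_f_ge[where v="block_mixture u N"])
         (use Sint block_mixture_nonneg block_mixture_block block_mixture_integral block_mixture_lower_bound[OF c] in auto)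
    moreover have "(\<integral>x. c * real N - (c + 1) * (real K + ?S N x) \<partial>P) = c * real N - (c + 1) * (real K + real N * ?\<beta>)"
      using Sint[of N] S[of N] prob_space by simp
    ultimately show ?thesis by simp
  qed
  note * = this
  have "(\<lambda>N. c - (c + 1) * (real K / real N + ?\<beta>)) \<longlonglongrightarrow> c - (c + 1) * (0 + ?\<beta>)"
    by (intro tendsto_intros lim_const_over_n)
  then have "c - (c + 1) * (0 + ?\<beta>) \<le> D"
  proof (rule LIMSEQ_le[OF _ f_rate])
    show "\<exists>N. \<forall>n\<ge>N. c - (c + 1) * (real K / real n + ?\<beta>) \<le> (\<integral>x. log 2 (f n x) \<partial>P) / real n"
    proof (intro exI allI impI)
      fix n :: nat assume "n \<ge> 1"
      then have n: "real n > 0" by simp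
      have "c - (c + 1) * (real K / real n + ?\<beta>) = (c * real n - (c + 1) * (real K + real n * ?\<beta>)) / real n"
        using n by (simp add: field_simps)
      then show "c - (c + 1) * (real K / real n + ?\<beta>) \<le> (\<integral>x. log 2 (f n x) \<partial>P) / real n"
        using *[of n] n by (simp add: divide_right_mono)
    qed
  qed
  then show ?thesis by simp
qed

text \<open>If the bound failed with positive probability, recurrence would produce such failures
  after a wait along almost every trajectory. Then almost every point is good at an intermediate
  rate \<open>c'\<close> for some \<open>K\<close>, the bad probability tends to 0 as
  \<open>K\<close> grows, and \<open>sub_density_bad_prob\<close> yields
  \<open>c' \<le> D\<close>.\<close>

lemma sub_density_eventually_le:
  assumes u: "sub_density \<mu> u" and c: "D < c"
  shows "AE x in P. \<forall>\<^sub>F n in sequentially. u n x \<le> 2 powr (c * real n)"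
proof -
  interpret sub_density \<mu> u by fact
  have [measurable]: "u n \<in> borel_measurable P" for n by measurable
  define B where "B = {x. \<exists>\<^sub>F n in sequentially. \<not> u n x \<le> 2 powr (c * real n)}"
  have "{x \<in> space P. \<exists>\<^sub>F n in sequentially. \<not> u n x \<le> 2 powr (c * real n)} \<in> events"
    unfolding frequently_def eventually_sequentially by measurable
  then have Bm: "B \<in> events" by (simp add: B_def)
  have "prob B = 0"
  proof (rule ccontr)
    assume "prob B \<noteq> 0"
    then have "prob B > 0" using measure_nonneg[of P B] by linarith
    from recurrence[OF Bm this] have rec: "AE x in P. \<exists>k. shift_by k x \<in> B" .
    define c' where "c' = (D + c) / 2"
    have c': "D < c'" "c' < c" "c' \<ge> 0" using c D_nonneg by (auto simp: c'_def)
    have good: "x \<in> (\<Union>K. good c' K)" if "shift_by k x \<in> B" for x k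
    proof -
      \<comment> \<open>The slack \<open>c - c'\<close> per letter of the block eventually outweighs
        the fixed price of the \<open>k\<close> waiting letters, the bit for choosing a block, and
        the logarithmic price of its length.\<close>
      have "filterlim (\<lambda>j. (c - c') * real (Suc j) - c' * real k - real k - 1 + log 2 (1 / ((real j + 1) * (real j + 2)))) at_top sequentially"
        using c' by real_asymp
      then have "\<forall>\<^sub>F j in sequentially. (c - c') * real (Suc j) - c' * real k - real k - 1 + log 2 (1 / ((real j + 1) * (real j + 2))) \<ge> 0"
        by (auto simp: filterlim_at_top)
      then obtain J where J: "\<And>j. j \<ge> J \<Longrightarrow> (c - c') * real (Suc j) - c' * real k - real k - 1 + log 2 (npd_weight j) \<ge> 0"
        by (auto simp: eventually_sequentially npd_weight_eq)
      have "\<exists>n\<ge>Suc J. \<not> u n (shift_by k x) \<le> 2 powr (c * real n)"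
      proof (rule ccontr)
        assume "\<not> ?thesis"
        then have "\<forall>\<^sub>F n in sequentially. u n (shift_by k x) \<le> 2 powr (c * real n)"
          by (auto simp: eventually_sequentially)
        then show False
          using that by (simp only: B_def mem_Collect_eq frequently_def not_not not_True_eq_False)
      qed
      then obtain n where "n \<ge> Suc J" and n: "\<not> u n (shift_by k x) \<le> 2 powr (c * real n)"
        by blast
      then obtain j where j: "n = Suc j" "j \<ge> J" by (cases n) auto
      have "c' * real (k + Suc j) \<le> - real k + (log 2 (npd_weight j) - 1 + c * real (Suc j))"
        using J[OF j(2)] by (simp add: algebra_simps)
      then have "2 powr (c' * real (k + Suc j)) \<le> 2 powr (- real k + (log 2 (npd_weight j) - 1 + c * real (Suc j)))"
        by simp
      also have "\<dots> = (1/2) ^ k * (npd_weight j / 2 * 2 powr (c * real (Suc j)))"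
        unfolding powr_add powr_diff
        using npd_weight_pos[of j] by (simp add: powr_minus powr_realpow power_one_over inverse_eq_divide)
      also have "\<dots> \<le> (1/2) ^ k * (npd_weight j / 2 * u (Suc j) (shift_by k x))"
        using n npd_weight_pos[of j] unfolding j by (intro mult_left_mono) auto
      finally show ?thesis unfolding good_def by blast
    qed
    have gm: "good c' K \<in> events" for K by measurable
    have "incseq (good c')"
      unfolding good_def incseq_def by (blast intro: order_trans)
    then have "(\<lambda>K. prob (good c' K)) \<longlonglongrightarrow> prob (\<Union>K. good c' K)"
      using gm by (intro finite_Lim_measure_incseq) auto
    moreover have "prob (\<Union>K. good c' K) = 1"
      by (subst prob_eq_1) (use gm rec good in \<open>auto elim!: eventually_mono\<close>)
    ultimately have lim: "(\<lambda>K. prob (good c' K)) \<longlonglongrightarrow> 1" by simp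
    have "prob (- good c' K) = 1 - prob (good c' K)" for K
      using prob_compl[OF gm[of K]] by (simp add: Compl_eq_Diff_UNIV)
    then have "c' - (c' + 1) * (1 - prob (good c' K)) \<le> D" for K
      using sub_density_bad_prob[OF u c'(3), of K] by simp
    moreover have "(\<lambda>K. c' - (c' + 1) * (1 - prob (good c' K))) \<longlonglongrightarrow> c' - (c' + 1) * (1 - 1)"
      by (intro tendsto_intros lim)
    ultimately have "c' - (c' + 1) * (1 - 1) \<le> D"
      by (intro LIMSEQ_le_const2) auto
    then show False using c' by simp
  qed
  then have "AE x in P. x \<notin> B"
    using AE_iff_measurable[of B P "\<lambda>x. x \<notin> B"] Bm by (auto simp: emeasure_eq_measure)
  then show ?thesis
    by eventually_elim (auto simp: B_def frequently_def)
qed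

end

section \<open>Entropy of the quantized process\<close>

lemma sum_int_interval: "(\<Sum>i\<in>{1..int n}. h i) = (\<Sum>i<n. h (int i + 1))"
  by (rule sum.reindex_bij_witness[of _ "\<lambda>i. int i + 1" "\<lambda>i. nat (i - 1)"]) auto

lemma prod_int_interval: "(\<Prod>i\<in>{1..int n}. h i) = (\<Prod>i<n. h (int i + 1))"
  by (rule prod.reindex_bij_witness[of _ "\<lambda>i. int i + 1" "\<lambda>i. nat (i - 1)"]) auto

lemma ball_int_interval: "(\<forall>i\<in>{1..int n}. Q i) \<longleftrightarrow> (\<forall>i<n. Q (int i + 1))"
proof (intro iffI ballI allI impI)
  fix i assume "\<forall>i<n. Q (int i + 1)" "i \<in> {1..int n}"
  then show "Q i" by (auto dest!: spec[of _ "nat (i - 1)"])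
qed auto

text \<open>Fekete's subadditive lemma, with the limit identified as an infimum: besides the
  existence of the entropy rate, its comparison with every single block length is needed.\<close>

lemma fekete_nonneg:
  fixes a :: "nat \<Rightarrow> real"
  assumes sub: "\<And>m n. a (m + n) \<le> a m + a n" and nonneg: "\<And>n. a n \<ge> 0"
  obtains H where "(\<lambda>n. a n / real n) \<longlonglongrightarrow> H" "\<And>n. n \<ge> 1 \<Longrightarrow> H \<le> a n / real n"
proof -
  define H where "H = (INF n\<in>{1..}. a n / real n)"
  have bdd: "bdd_below ((\<lambda>n. a n / real n) ` {1..})"
    by (rule bdd_belowI2[of _ 0]) (use nonneg in auto)
  have le: "H \<le> a n / real n" if "n \<ge> 1" for n
    unfolding H_def by (rule cINF_lower[OF bdd]) (use that in auto)
  have mult: "a (q * k) \<le> real q * a k" if "q \<ge> 1" for q k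
    using that
  proof (induction q rule: dec_induct)
    case (step q)
    have "a (Suc q * k) \<le> a k + a (q * k)" using sub[of k "q * k"] by simp
    then show ?case using step by (simp add: algebra_simps)
  qed simp
  have "(\<lambda>n. a n / real n) \<longlonglongrightarrow> H"
  proof (rule LIMSEQ_I)
    fix r :: real assume r: "r > 0"
    have "(INF n\<in>{1..}. a n / real n) < H + r / 2" using r by (simp add: H_def)
    then obtain k where k: "k \<ge> 1" "a k / real k < H + r / 2"
      by (subst (asm) cINF_less_iff) (use bdd in auto)
    \<comment> \<open>A bound for the contribution of the remainder \<open>n mod k\<close>.\<close>
    define B where "B = (\<Sum>i<2 * k. a i)"
    have B: "a i \<le> B" if "i < 2 * k" for i
      unfolding B_def by (rule member_le_sum) (use that nonneg in auto)
    have B0: "B \<ge> 0" unfolding B_def by (rule sum_nonneg) (use nonneg in auto)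
    have bound: "a n \<le> real n * (a k / real k) + B" if n: "n \<ge> k" for n
    proof -
      define q where "q = n div k"
      have q: "q \<ge> 1" "n = q * k + n mod k" using n k by (auto simp: q_def div_greater_zero_iff Suc_le_eq)
      have "a n \<le> a (q * k) + a (n mod k)" using sub[of "q * k" "n mod k"] q by simp
      also have "\<dots> \<le> real q * a k + B"
        using mult[OF q(1), of k] B[of "n mod k"] mod_less_divisor[of k n] k by (intro add_mono) linarith+
      also have "real q * a k \<le> real n * (a k / real k)"
      proof -
        have "real q * real k \<le> real n" using q(2) by (metis le_add1 of_nat_le_iff of_nat_mult)
        then have "real q * real k * (a k / real k) \<le> real n * (a k / real k)"
          using nonneg[of k] by (intro mult_right_mono) auto
        then show ?thesis using k by simp
      qed
      finally show ?thesis by simp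
    qed
    obtain N :: nat where N: "real N > 2 * B / r" using reals_Archimedean2 by blast
    show "\<exists>no. \<forall>n\<ge>no. norm (a n / real n - H) < r"
    proof (intro exI allI impI)
      fix n assume n: "max N k \<le> n"
      then have n1: "n \<ge> 1" "real n > 0" using k by auto
      have "2 * B / r < real n" using N n by linarith
      then have "B / real n < r / 2" using r n1 by (simp add: field_simps)
      moreover have "a n / real n \<le> a k / real k + B / real n"
        using bound[of n] n n1 by (simp add: field_simps)
      ultimately show "norm (a n / real n - H) < r"
        using le[OF n1(1)] k(2) unfolding real_norm_def by linarith
    qed
  qed
  then show ?thesis using le that by blast
qed

text \<open>The weights \<open>q\<close> need not have total mass 1; by
  \<open>ln y \<le> y - 1\<close> their excess mass enters linearly. With \<open>q\<close> a product
  of marginals this yields subadditivity of entropy, with \<open>q\<close> an exponential tilt the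
  Donsker-Varadhan inequality.\<close>

lemma finite_gibbs:
  fixes p q :: "'a \<Rightarrow> real"
  assumes "finite W" and p: "\<And>w. w \<in> W \<Longrightarrow> p w \<ge> 0" and q: "\<And>w. w \<in> W \<Longrightarrow> q w \<ge> 0"
    and pq: "\<And>w. w \<in> W \<Longrightarrow> p w > 0 \<Longrightarrow> q w > 0"
  shows "(\<Sum>w\<in>W. p w * log 2 (q w)) - ((\<Sum>w\<in>W. q w) - (\<Sum>w\<in>W. p w)) / ln 2 \<le> (\<Sum>w\<in>W. p w * log 2 (p w))"
proof -
  have "p w * log 2 (q w) - (q w - p w) / ln 2 \<le> p w * log 2 (p w)" if "w \<in> W" for w
  proof (cases "p w = 0")
    case True
    then show ?thesis using q[OF that] by simp
  next
    case False
    then have pos: "p w > 0" "q w > 0" using p[OF that] pq[OF that] by auto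
    have "ln (q w / p w) \<le> q w / p w - 1" using ln_le_minus_one[of "q w / p w"] pos by simp
    then have "p w * (ln (q w) - ln (p w)) \<le> q w - p w"
      using pos mult_left_mono[of "ln (q w / p w)" "q w / p w - 1" "p w"] by (simp add: ln_div right_diff_distrib)
    then have "p w * (ln (q w) - ln (p w)) / ln 2 \<le> (q w - p w) / ln 2"
      by (intro divide_right_mono) auto
    then show ?thesis by (simp add: log_def algebra_simps diff_divide_distrib)
  qed
  then have "(\<Sum>w\<in>W. p w * log 2 (q w) - (q w - p w) / ln 2) \<le> (\<Sum>w\<in>W. p w * log 2 (p w))"
    by (rule sum_mono)
  then show ?thesis
    by (simp add: sum_subtractf sum_divide_distrib[symmetric] diff_divide_distrib)
qed

section \<open>Cells and words of a finite partition\<close>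

locale finite_partition =
  fixes A :: "real set set"
  assumes finite_A [simp]: "finite A" and A_borel: "c \<in> A \<Longrightarrow> c \<in> sets borel"
    and A_nonempty: "c \<in> A \<Longrightarrow> c \<noteq> {}" and A_disjoint: "disjoint A" and A_cover: "\<Union>A = UNIV"
begin

lemma cell_in [simp]: "cell A v \<in> A" and in_cell: "v \<in> cell A v"
proof -
  obtain c where c: "c \<in> A" "v \<in> c" using A_cover by blast
  have "cell A v \<in> A \<and> v \<in> cell A v"
    unfolding cell_def by (rule theI[of _ c]) (use c A_disjoint in \<open>auto simp: disjoint_def\<close>)
  then show "cell A v \<in> A" "v \<in> cell A v" by auto
qed

lemma cell_eq: "c \<in> A \<Longrightarrow> v \<in> c \<Longrightarrow> cell A v = c"
  using cell_in[of v] in_cell[of v] A_disjoint unfolding disjoint_def by blast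

lemma cell_eq_iff: "c \<in> A \<Longrightarrow> cell A v = c \<longleftrightarrow> v \<in> c"
  using cell_eq in_cell by auto

lemma cell_measurable [measurable]: "cell A \<in> borel \<rightarrow>\<^sub>M count_space A"
  by (subst measurable_count_space_eq2) (auto simp: cell_eq_iff vimage_def A_borel)

lemma sigma_sets_saturated:
  assumes "B \<in> sigma_sets UNIV A" "cell A v = cell A v'"
  shows "v \<in> B \<longleftrightarrow> v' \<in> B"
  using assms(1)
proof induction
  case (Basic c)
  then show ?case using assms(2) cell_eq_iff by metis
qed auto

definition word :: "nat \<Rightarrow> (int \<Rightarrow> real) \<Rightarrow> real set list" where
  "word n x = map (\<lambda>i. cell A (x (int i + 1))) [0..<n]"

definition words :: "nat \<Rightarrow> real set list set" where
  "words n = {w. length w = n \<and> set w \<subseteq> A}"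

lemma finite_words [simp]: "finite (words n)"
  unfolding words_def using finite_lists_length_eq[OF finite_A, of n] by (simp add: conj_commute)

lemma word_in_words [simp]: "word n x \<in> words n"
  by (auto simp: word_def words_def)

lemma word_eq_iff: "w \<in> words n \<Longrightarrow> word n x = w \<longleftrightarrow> (\<forall>i<n. cell A (x (int i + 1)) = w ! i)"
  by (auto simp: word_def words_def list_eq_iff_nth_eq)

lemma word_eq_word_iff: "word n x = word n y \<longleftrightarrow> (\<forall>i\<in>{1..int n}. cell A (x i) = cell A (y i))"
  unfolding ball_int_interval by (auto simp: word_def)

lemma word_event [measurable]:
  assumes "{1..int n} \<subseteq> I" and w: "w \<in> words n"
  shows "{x \<in> space (\<Pi>\<^sub>M i\<in>I. borel). word n x = w} \<in> sets (\<Pi>\<^sub>M i\<in>I. borel)"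
proof -
  have [measurable]: "(\<lambda>x. cell A (x (int i + 1))) \<in> (\<Pi>\<^sub>M i\<in>I. borel) \<rightarrow>\<^sub>M count_space A" if "i < n" for i
    using that assms(1) by (intro measurable_compose[OF _ cell_measurable] measurable_component_singleton) auto
  have "{x \<in> space (\<Pi>\<^sub>M i\<in>I. borel). \<forall>i\<in>{..<n}. cell A (x (int i + 1)) = w ! i} \<in> sets (\<Pi>\<^sub>M i\<in>I. borel)"
  proof (rule sets.sets_Collect_finite_All)
    fix i assume "i \<in> {..<n}"
    then have i: "i < n" by simp
    have "w ! i \<in> A" using w i by (auto simp: words_def)
    then show "{x \<in> space (\<Pi>\<^sub>M i\<in>I. borel). cell A (x (int i + 1)) = w ! i} \<in> sets (\<Pi>\<^sub>M i\<in>I. borel)"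
      using i by measurable
  qed simp
  then show ?thesis
    by (simp add: word_eq_iff[OF w] Ball_def)
qed

text \<open>Reduces measurability and integration of functions of a word to word events. The
  semiring type covers real and \<open>ennreal\<close> integrands alike.\<close>

lemma word_function_eq: "G (word n x) = (\<Sum>w\<in>words n. (G w :: 'b :: semiring_1) * indicator {x. word n x = w} x)"
proof -
  have "(\<Sum>w\<in>words n. G w * indicator {x. word n x = w} x) = (\<Sum>w\<in>words n. if w = word n x then G w else 0)"
    by (rule sum.cong) (auto split: split_indicator)
  then show ?thesis by simp
qed

lemma word_function_measurable:
  fixes G :: "real set list \<Rightarrow> 'b :: {second_countable_topology, real_normed_algebra_1}"
  assumes "{1..int n} \<subseteq> I"
  shows "(\<lambda>x. G (word n x)) \<in> borel_measurable (\<Pi>\<^sub>M i\<in>I. borel)"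
proof -
  have "(\<lambda>x. \<Sum>w\<in>words n. G w * indicator {x \<in> space (\<Pi>\<^sub>M i\<in>I. borel). word n x = w} x) \<in> borel_measurable (\<Pi>\<^sub>M i\<in>I. borel)"
    by (intro borel_measurable_sum borel_measurable_times borel_measurable_const borel_measurable_indicator word_event assms)
  then show ?thesis
    by (rule measurable_cong[THEN iffD1, rotated]) (subst word_function_eq, auto intro!: sum.cong split: split_indicator)
qed

end

text \<open>Instantiated with both \<open>P\<close> and \<open>M\<close>, whose word probabilities
  are compared later.\<close>

locale partition_measure = finite_partition A + prob_space N
  for A :: "real set set" and N :: "(int \<Rightarrow> real) measure" +
  assumes sets_N [measurable_cong]: "sets N = sets (\<Pi>\<^sub>M i\<in>UNIV. borel)"
begin

lemma space_N [simp]: "space N = UNIV"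
  using sets_eq_imp_space_eq[OF sets_N] by (simp add: space_PiM PiE_UNIV_domain)

definition wp :: "real set list \<Rightarrow> real" where
  "wp w = prob {x. word (length w) x = w}"

lemma wp_eq: "w \<in> words n \<Longrightarrow> wp w = prob {x. word n x = w}"
  by (auto simp: wp_def words_def)

lemma wp_nonneg [simp]: "wp w \<ge> 0"
  by (simp add: wp_def)

lemma word_event_N [measurable, simp]: "w \<in> words n \<Longrightarrow> {x. word n x = w} \<in> events"
  using word_event[of n UNIV w] by (simp add: sets_N space_PiM PiE_UNIV_domain)

lemma integrable_word: "integrable N (\<lambda>x. G (word n x) :: real)"
  by (subst word_function_eq)
     (intro Bochner_Integration.integrable_sum integrable_mult_right integrable_real_indicator word_event_N,
       simp_all add: emeasure_eq_measure)

lemma integral_word: "(\<integral>x. (G (word n x) :: real) \<partial>N) = (\<Sum>w\<in>words n. wp w * G w)"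
proof -
  have "(\<integral>x. G (word n x) \<partial>N) = (\<Sum>w\<in>words n. (\<integral>x. G w * indicator {x. word n x = w} x \<partial>N))"
    by (subst word_function_eq, rule Bochner_Integration.integral_sum)
       (intro integrable_mult_right integrable_real_indicator word_event_N, simp_all add: emeasure_eq_measure)
  also have "\<dots> = (\<Sum>w\<in>words n. wp w * G w)"
    by (intro sum.cong) (auto simp: wp_eq)
  finally show ?thesis .
qed

lemma nn_integral_word: "(\<integral>\<^sup>+x. G (word n x) \<partial>N) = (\<Sum>w\<in>words n. ennreal (wp w) * G w)"
proof -
  have "(\<integral>\<^sup>+x. G (word n x) \<partial>N) = (\<Sum>w\<in>words n. (\<integral>\<^sup>+x. G w * indicator {x. word n x = w} x \<partial>N))"
    by (subst word_function_eq, rule nn_integral_sum) auto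
  also have "\<dots> = (\<Sum>w\<in>words n. ennreal (wp w) * G w)"
    by (intro sum.cong) (auto simp: wp_eq nn_integral_cmult_indicator emeasure_eq_measure mult.commute)
  finally show ?thesis .
qed

lemma sum_wp: "(\<Sum>w\<in>words n. wp w) = 1"
  using integral_word[of "\<lambda>_. 1" n] prob_space by simp

end

text \<open>\<open>null_cells\<close> is the form of absolute continuity required at a single level:
  it keeps the denominators of NPD positive almost surely. Stationarity extends it from coordinate 1
  to the other positive coordinates.\<close>

locale quantized_process = stationary_process P + dominating_product \<mu> + finite_partition A
  for P :: "(int \<Rightarrow> real) measure" and \<mu> :: "real measure" and A :: "real set set" +
  assumes null_cells: "c \<in> A \<Longrightarrow> measure \<mu> c = 0 \<Longrightarrow> AE x in P. x 1 \<notin> c"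
begin

sublocale PP: partition_measure A P
  by unfold_locales (rule sets_P)

sublocale MM: partition_measure A M
  by unfold_locales (rule sets_M)

lemma MM_wp: "w \<in> words n \<Longrightarrow> MM.wp w = (\<Prod>i<n. measure \<mu> (w ! i))"
proof -
  assume w: "w \<in> words n"
  have wA: "w ! i \<in> A" if "i < n" for i using w that by (auto simp: words_def)
  have "MM.wp w = measure M {x \<in> space M. \<forall>i\<in>{1..int n}. x i \<in> w ! nat (i - 1)}"
  proof -
    have "word n x = w \<longleftrightarrow> (\<forall>i\<in>{1..int n}. x i \<in> w ! nat (i - 1))" for x
      unfolding word_eq_iff[OF w] ball_int_interval using wA by (simp add: cell_eq_iff)
    then show ?thesis using MM.wp_eq[OF w] by simp
  qed
  also have "\<dots> = (\<Prod>i\<in>{1..int n}. measure \<mu> (w ! nat (i - 1)))"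
  proof -
    have "emeasure M {x \<in> space M. \<forall>i\<in>{1..int n}. x i \<in> w ! nat (i - 1)}
        = (\<Prod>i\<in>{1..int n}. emeasure \<mu> (w ! nat (i - 1)))"
      unfolding M_def
    proof (rule product.emeasure_PiM_Collect)
      fix i assume "i \<in> {1..int n}"
      then have "nat (i - 1) < n" by auto
      then show "w ! nat (i - 1) \<in> sets \<mu>" using A_borel[OF wA] sets_mu by blast
    qed auto
    also have "\<dots> = ennreal (\<Prod>i\<in>{1..int n}. measure \<mu> (w ! nat (i - 1)))"
      by (simp add: product.M.emeasure_eq_measure prod_ennreal)
    finally show ?thesis
      by (simp add: measure_def[of M] prod_nonneg)
  qed
  also have "\<dots> = (\<Prod>i<n. measure \<mu> (w ! i))"
    by (simp add: prod_int_interval)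
  finally show ?thesis .
qed

lemma MM_wp_word: "MM.wp (word n x) = (\<Prod>i<n. measure \<mu> (cell A (x (int i + 1))))"
  by (subst MM_wp[OF word_in_words]) (simp add: word_def)

lemma AE_cells_pos: "AE x in P. \<forall>k. measure \<mu> (cell A (x (int k + 1))) > 0"
proof (subst AE_all_countable, rule allI)
  fix k
  have "AE x in P. \<forall>c\<in>A. measure \<mu> c = 0 \<longrightarrow> x 1 \<notin> c"
    using null_cells by (intro AE_finite_allI) auto
  then have "AE x in P. measure \<mu> (cell A (x 1)) > 0"
  proof eventually_elim
    case (elim x)
    then have "measure \<mu> (cell A (x 1)) \<noteq> 0" using cell_in in_cell by blast
    then show ?case using measure_nonneg[of \<mu> "cell A (x 1)"] by linarith
  qed
  then have "AE x in P. measure \<mu> (cell A (shift_by k x 1)) > 0"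
    by (rule AE_shift_by)
  then show "AE x in P. measure \<mu> (cell A (x (int k + 1))) > 0"
    by (simp add: shift_by_def add.commute)
qed

lemma MM_wp_pos: "w \<in> words n \<Longrightarrow> PP.wp w > 0 \<Longrightarrow> MM.wp w > 0"
proof (rule ccontr)
  assume w: "w \<in> words n" and pos: "PP.wp w > 0" and "\<not> MM.wp w > 0"
  then have 0: "MM.wp w = 0" using MM.wp_nonneg[of w] by linarith
  have "AE x in P. word n x \<noteq> w"
    using AE_cells_pos
  proof eventually_elim
    case (elim x)
    then have "MM.wp (word n x) > 0" unfolding MM_wp_word by (intro prod_pos) auto
    then show ?case using 0 by auto
  qed
  then have "PP.wp w = 0"
    using AE_iff_measurable[of "{x. word n x = w}" P "\<lambda>x. word n x \<noteq> w"] w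
    by (auto simp: PP.wp_eq[OF w] emeasure_eq_measure)
  then show False using pos by simp
qed

definition Q :: "(int \<Rightarrow> real set) measure" where
  "Q = distr P (\<Pi>\<^sub>M i\<in>UNIV. count_space A) (\<lambda>x i. cell A (x i))"

lemma cells_measurable [measurable]: "(\<lambda>x i. cell A (x i)) \<in> P \<rightarrow>\<^sub>M (\<Pi>\<^sub>M i\<in>UNIV. count_space A)"
proof -
  have "(\<lambda>x i. cell A (x i)) \<in> (\<Pi>\<^sub>M i\<in>UNIV. borel) \<rightarrow>\<^sub>M (\<Pi>\<^sub>M i\<in>UNIV. count_space A)"
    by (rule measurable_PiM_single') (auto intro!: measurable_compose[OF _ cell_measurable])
  then show ?thesis by (simp add: measurable_cong_sets[OF sets_P refl])
qed

lemma sets_Q [measurable_cong]: "sets Q = sets (\<Pi>\<^sub>M i\<in>UNIV. count_space A)"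
  by (simp add: Q_def)

lemma space_Q: "space Q = {y. \<forall>i. y i \<in> A}"
  by (auto simp: Q_def space_PiM PiE_def)

text \<open>Passing to cells coordinate by coordinate commutes with the shift, so \<open>Q\<close>
  is a factor of \<open>P\<close>: invariance of the law carries over, and invariant events pull
  back to invariant events.\<close>

lemma stationary_ergodic_Q: "stationary_ergodic (count_space A) Q"
  unfolding stationary_ergodic_def
proof (intro conjI ballI impI)
  show "prob_space Q" unfolding Q_def by (rule prob_space_distr) measurable
  show "sets Q = sets (\<Pi>\<^sub>M i\<in>UNIV. count_space A)" by (rule sets_Q)
  have sh: "shift \<in> Q \<rightarrow>\<^sub>M Q"
    unfolding shift_conv_shift_by measurable_cong_sets[OF sets_Q sets_Q] by (rule measurable_shift_by_PiM)
  have c: "(\<lambda>x i. cell A (x i)) \<in> P \<rightarrow>\<^sub>M Q"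
    unfolding measurable_cong_sets[OF refl sets_Q] by (rule cells_measurable)
  have Q': "Q = distr P Q (\<lambda>x i. cell A (x i))"
    unfolding Q_def by (rule distr_cong) (auto simp: Q_def)
  have "distr Q Q shift = distr P Q (shift \<circ> (\<lambda>x i. cell A (x i)))"
    by (subst (1) Q') (rule distr_distr[OF sh c])
  also have "shift \<circ> (\<lambda>x i. cell A (x i)) = (\<lambda>x i. cell A (x i)) \<circ> shift_by 1"
    by (auto simp: shift_def shift_by_def fun_eq_iff)
  also have "distr P Q \<dots> = distr (distr P P (shift_by 1)) Q (\<lambda>x i. cell A (x i))"
    by (rule distr_distr[symmetric, OF c measurable_shift_by])
  also have "\<dots> = Q" unfolding distr_shift_by Q'[symmetric] ..
  finally show "distr Q Q shift = Q" .
  fix B assume B: "B \<in> sets Q" "shift -` B \<inter> space Q = B"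
  let ?B = "(\<lambda>x i. cell A (x i)) -` B"
  have "?B \<in> events" using measurable_sets[OF c B(1)] by simp
  moreover have "shift x \<in> ?B \<longleftrightarrow> x \<in> ?B" for x
  proof -
    have "(\<lambda>i. cell A (x i)) \<in> B \<longleftrightarrow> (\<lambda>i. cell A (x i)) \<in> shift -` B \<inter> space Q" using B(2) by simp
    also have "\<dots> \<longleftrightarrow> shift x \<in> ?B" by (simp add: space_Q shift_def)
    finally show ?thesis by simp
  qed
  ultimately have "prob ?B = 0 \<or> prob ?B = 1" by (rule invariant_event_trivial)
  moreover have "emeasure Q B = emeasure P ?B"
    by (subst Q') (use emeasure_distr[OF c B(1)] in simp)
  ultimately show "emeasure Q B = 0 \<or> emeasure Q B = 1"
    by (auto simp: emeasure_eq_measure)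
qed

lemma measure_Q_word_cyl: "w \<in> words n \<Longrightarrow> measure Q (word_cyl Q w) = PP.wp w"
proof -
  assume w: "w \<in> words n"
  have l: "length w = n" using w by (simp add: words_def)
  have "word_cyl Q w = {y \<in> space Q. \<forall>i\<in>{..<n}. y (int i + 1) = w ! i}"
    by (auto simp: word_cyl_def l)
  also have "\<dots> \<in> sets Q"
  proof (rule sets.sets_Collect_finite_All)
    fix i assume "i \<in> {..<n}"
    then have "w ! i \<in> A" using w by (auto simp: words_def)
    then show "{y \<in> space Q. y (int i + 1) = w ! i} \<in> sets Q" by measurable
  qed simp
  finally have m: "word_cyl Q w \<in> sets (\<Pi>\<^sub>M i\<in>UNIV. count_space A)" by (simp add: sets_Q)
  have "measure Q (word_cyl Q w) = prob ((\<lambda>x i. cell A (x i)) -` word_cyl Q w)"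
    by (subst Q_def) (use measure_distr[OF cells_measurable m] in simp)
  also have "(\<lambda>x i. cell A (x i)) -` word_cyl Q w = {x. word n x = w}"
    by (auto simp: word_cyl_def space_Q word_eq_iff[OF w] l)
  finally show ?thesis using PP.wp_eq[OF w] by simp
qed

lemma block_entropy_Q: "block_entropy Q A n = - (\<Sum>w\<in>words n. PP.wp w * log 2 (PP.wp w))"
  unfolding block_entropy_def words_def[symmetric] by (simp add: measure_Q_word_cyl cong: sum.cong)

lemma block_entropy_Q_nonneg: "block_entropy Q A n \<ge> 0"
proof -
  have "PP.wp w * log 2 (PP.wp w) \<le> 0" for w
  proof (cases "PP.wp w = 0")
    case False
    then have "PP.wp w > 0" "PP.wp w \<le> 1" using PP.wp_nonneg[of w] by (auto simp: PP.wp_def less_le)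
    then show ?thesis by (intro mult_nonneg_nonpos) (auto simp: log_le_zero_cancel_iff)
  qed simp
  then show ?thesis unfolding block_entropy_Q by (simp add: sum_nonpos)
qed

lemma take_word: "take m (word (m + n) x) = word m x"
  by (auto simp: word_def take_map)

lemma drop_word: "drop m (word (m + n) x) = word n (shift_by m x)"
  by (rule nth_equalityI) (auto simp: word_def shift_by_def add_ac)

lemma take_in_words: "w \<in> words (m + n) \<Longrightarrow> take m w \<in> words m"
  and drop_in_words: "w \<in> words (m + n) \<Longrightarrow> drop m w \<in> words n"
  using set_take_subset[of m w] set_drop_subset[of m w] by (auto simp: words_def)

text \<open>Nonnegativity of the mutual information of two adjacent blocks:
  \<open>finite_gibbs\<close> compares the joint law with the product of the marginals, and
  stationarity moves the second block to the origin.\<close>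

lemma block_entropy_Q_subadditive: "block_entropy Q A (m + n) \<le> block_entropy Q A m + block_entropy Q A n"
proof -
  let ?p = PP.wp and ?q = "\<lambda>w. PP.wp (take m w) * PP.wp (drop m w)"
  have pos: "?p (take m w) > 0 \<and> ?p (drop m w) > 0" if w: "w \<in> words (m + n)" "?p w > 0" for w
  proof -
    have "?p w \<le> ?p (take m w)"
      unfolding PP.wp_eq[OF w(1)] PP.wp_eq[OF take_in_words[OF w(1)]]
      by (rule finite_measure_mono)
         (use take_word PP.word_event_N[OF take_in_words[OF w(1)]] in auto)
    moreover have "?p w \<le> prob (shift_by m -` {x. word n x = drop m w})"
      unfolding PP.wp_eq[OF w(1)]
      by (rule finite_measure_mono)
         (use drop_word measurable_sets[OF measurable_shift_by PP.word_event_N[OF drop_in_words[OF w(1)]]] in auto)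
    then have "?p w \<le> ?p (drop m w)"
      unfolding PP.wp_eq[OF drop_in_words[OF w(1)]] prob_shift_by[OF PP.word_event_N[OF drop_in_words[OF w(1)]]] .
    ultimately show ?thesis using w(2) by linarith
  qed
  have "(\<Sum>w\<in>words (m + n). ?q w) = (\<Sum>(v, w)\<in>words m \<times> words n. ?p v * ?p w)"
    by (rule sum.reindex_bij_witness[of _ "\<lambda>(v, w). v @ w" "\<lambda>w. (take m w, drop m w)"])
       (auto simp: words_def dest: in_set_takeD in_set_dropD)
  also have "\<dots> = 1"
    unfolding sum.cartesian_product[symmetric] sum_product[symmetric] by (simp add: PP.sum_wp)
  finally have q1: "(\<Sum>w\<in>words (m + n). ?q w) = 1" .
  have "(\<Sum>w\<in>words (m + n). ?p w * log 2 (?q w)) =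
      (\<Sum>w\<in>words (m + n). ?p w * (log 2 (?p (take m w)) + log 2 (?p (drop m w))))"
  proof (rule sum.cong)
    fix w assume w: "w \<in> words (m + n)"
    show "?p w * log 2 (?q w) = ?p w * (log 2 (?p (take m w)) + log 2 (?p (drop m w)))"
      using pos[OF w] PP.wp_nonneg[of w] by (cases "?p w = 0") (auto simp: log_mult less_le)
  qed simp
  also have "\<dots> = (\<integral>x. log 2 (?p (take m (word (m + n) x))) + log 2 (?p (drop m (word (m + n) x))) \<partial>P)"
    by (rule PP.integral_word[symmetric])
  also have "\<dots> = (\<integral>x. log 2 (?p (word m x)) + log 2 (?p (word n (shift_by m x))) \<partial>P)"
    by (simp only: take_word drop_word)
  also have "\<dots> = (\<integral>x. log 2 (?p (word m x)) \<partial>P) + (\<integral>x. log 2 (?p (word n x)) \<partial>P)"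
    using PP.integrable_word[of "\<lambda>w. log 2 (?p w)"] integrable_shift_by[of "\<lambda>x. log 2 (?p (word n x))" m]
      integral_shift_by[of "\<lambda>x. log 2 (?p (word n x))" m]
    by (subst Bochner_Integration.integral_add) auto
  also have "\<dots> = - block_entropy Q A m - block_entropy Q A n"
    unfolding block_entropy_Q
    using PP.integral_word[of "\<lambda>w. log 2 (?p w)" m] PP.integral_word[of "\<lambda>w. log 2 (?p w)" n] by simp
  finally show ?thesis
    using finite_gibbs[of "words (m + n)" ?p ?q] pos q1 PP.sum_wp
    by (simp add: block_entropy_Q)
qed


section \<open>NPD at a single level and its growth rate\<close>

definition npd :: "(int \<Rightarrow> real set) measure \<Rightarrow> nat \<Rightarrow> (int \<Rightarrow> real) \<Rightarrow> real" where
  "npd R n x = prefix_prob R (\<lambda>i. cell A (x i)) n / (\<Prod>i\<in>{1..int n}. measure \<mu> (cell A (x i)))"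

text \<open>The numerator of \<open>npd\<close> as a function of the word, so that integrals of
  \<open>npd\<close> become finite sums.\<close>

definition word_prob :: "(int \<Rightarrow> real set) measure \<Rightarrow> real set list \<Rightarrow> real" where
  "word_prob R w = measure R {z \<in> space R. \<forall>i<length w. z (int i + 1) = w ! i}"

lemma npd_eq_word: "npd R n x = word_prob R (word n x) / MM.wp (word n x)"
  unfolding npd_def prefix_prob_def word_prob_def MM_wp_word prod_int_interval ball_int_interval
  by (simp add: word_def cong: conj_cong)

lemma npd_nonneg: "npd R n x \<ge> 0"
  unfolding npd_eq_word word_prob_def by simp

lemma npd_measurable [measurable]: "npd R n \<in> borel_measurable (\<Pi>\<^sub>M i\<in>UNIV. borel)"
  unfolding npd_eq_word[abs_def] by (rule word_function_measurable) auto

lemma npd_block: "depends_on_block n (npd R n)"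
  unfolding depends_on_block_def
proof (intro allI impI)
  fix x y :: "int \<Rightarrow> real" assume "\<forall>i\<in>{1..int n}. x i = y i"
  then have "word n x = word n y" by (simp add: word_eq_word_iff)
  then show "npd R n x = npd R n y" by (simp add: npd_eq_word)
qed

text \<open>Integration against \<open>M\<close> cancels the cell masses in the denominator and
  leaves \<open>R\<close>-probabilities of disjoint cylinders. Words of \<open>M\<close>-mass 0
  contribute 0, hence an inequality.\<close>

lemma npd_integral:
  assumes "prob_space R" and sets_R: "sets R = sets (\<Pi>\<^sub>M i\<in>UNIV. count_space A)"
  shows "(\<integral>\<^sup>+x. ennreal (npd R n x) \<partial>M) \<le> 1"
proof -
  interpret R: prob_space R by fact
  note [measurable_cong] = sets_R
  let ?C = "\<lambda>w. {z \<in> space R. \<forall>i\<in>{..<n}. z (int i + 1) = w ! i}"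
  have C: "?C w \<in> sets R" if "w \<in> words n" for w
  proof (rule sets.sets_Collect_finite_All)
    fix i assume "i \<in> {..<n}"
    then have "w ! i \<in> A" using that by (auto simp: words_def)
    then show "{z \<in> space R. z (int i + 1) = w ! i} \<in> sets R" by measurable
  qed simp
  have "(\<integral>\<^sup>+x. ennreal (npd R n x) \<partial>M) = (\<Sum>w\<in>words n. ennreal (MM.wp w) * ennreal (word_prob R w / MM.wp w))"
    unfolding npd_eq_word by (rule MM.nn_integral_word)
  also have "\<dots> \<le> (\<Sum>w\<in>words n. ennreal (word_prob R w))"
  proof (rule sum_mono)
    fix w show "ennreal (MM.wp w) * ennreal (word_prob R w / MM.wp w) \<le> ennreal (word_prob R w)"
      using MM.wp_nonneg[of w] by (cases "MM.wp w = 0") (auto simp: ennreal_mult[symmetric] word_prob_def)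
  qed
  also have "\<dots> = ennreal (\<Sum>w\<in>words n. word_prob R w)"
    by (rule sum_ennreal) (simp add: word_prob_def)
  also have "(\<Sum>w\<in>words n. word_prob R w) = (\<Sum>w\<in>words n. measure R (?C w))"
    by (rule sum.cong) (auto simp: word_prob_def words_def lessThan_def)
  also have "\<dots> = measure R (\<Union>w\<in>words n. ?C w)"
  proof (rule R.finite_measure_finite_Union[symmetric])
    show "disjoint_family_on ?C (words n)"
      by (auto simp: disjoint_family_on_def words_def intro!: nth_equalityI)
  qed (use C in auto)
  also have "ennreal \<dots> \<le> 1" by (simp add: ennreal_le_1)
  finally show ?thesis .
qed

text \<open>The limit \<open>d\<close> is \<open>- H\<close> minus the mean log mass of a cell, the
  relative entropy rate of the quantized process. The second conclusion bounds it below through an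
  arbitrary function of a word, a form that can be compared with the densities \<open>f n\<close>
  without further mention of entropy.\<close>

theorem npd_rate:
  assumes univ: "universal A R"
  obtains d where "AE x in P. (\<forall>n. npd R n x > 0) \<and> (\<lambda>n. log 2 (npd R n x) / real n) \<longlonglongrightarrow> d"
    and "\<And>n G. n \<ge> 1 \<Longrightarrow>
      (\<integral>x. G (word n x) \<partial>P) - ((\<integral>x. 2 powr G (word n x) \<partial>M) - 1) / ln 2 \<le> real n * d"
proof -
  define b where "b x = log 2 (measure \<mu> (cell A (x 1)))" for x :: "int \<Rightarrow> real"
  have b_word: "b x = log 2 (measure \<mu> (word 1 x ! 0))" for x
    by (simp add: b_def word_def)
  have b_int: "integrable P b"
    unfolding b_word[abs_def] by (rule PP.integrable_word)
  have b_sum: "AE x in P. \<forall>n. log 2 (MM.wp (word n x)) = (\<Sum>k<n. b (shift_by k x))"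
    using AE_cells_pos
  proof eventually_elim
    case (elim x)
    show ?case
    proof
      fix n
      have "measure \<mu> (cell A (x (int i + 1))) \<noteq> 0" for i
        using elim by (metis less_irrefl)
      then have "ln (\<Prod>i<n. measure \<mu> (cell A (x (int i + 1)))) = (\<Sum>i<n. ln (measure \<mu> (cell A (x (int i + 1)))))"
        by (intro ln_prod) auto
      then show "log 2 (MM.wp (word n x)) = (\<Sum>k<n. b (shift_by k x))"
        unfolding MM_wp_word log_def by (simp add: b_def log_def shift_by_def add.commute sum_divide_distrib)
    qed
  qed
  obtain H where H: "(\<lambda>n. block_entropy Q A n / real n) \<longlonglongrightarrow> H"
      and H_le: "\<And>n. n \<ge> 1 \<Longrightarrow> H \<le> block_entropy Q A n / real n"
    using fekete_nonneg[of "block_entropy Q A"] block_entropy_Q_subadditive block_entropy_Q_nonneg by blast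
  have "AE y in Q. (\<forall>n. prefix_prob R y n > 0) \<and> (\<lambda>n. - log 2 (prefix_prob R y n) / real n) \<longlonglongrightarrow> H"
    using univ stationary_ergodic_Q H unfolding universal_def by blast
  then have R: "AE x in P. (\<forall>n. prefix_prob R (\<lambda>i. cell A (x i)) n > 0) \<and>
      (\<lambda>n. - log 2 (prefix_prob R (\<lambda>i. cell A (x i)) n) / real n) \<longlonglongrightarrow> H"
    unfolding Q_def by (rule AE_distrD[OF cells_measurable])
  define d where "d = - H - (\<integral>x. b x \<partial>P)"
  show ?thesis
  proof (rule that)
    show "AE x in P. (\<forall>n. npd R n x > 0) \<and> (\<lambda>n. log 2 (npd R n x) / real n) \<longlonglongrightarrow> d"
      using R AE_cells_pos b_sum birkhoff[OF b_int]
    proof eventually_elim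
      case (elim x)
      let ?r = "\<lambda>n. prefix_prob R (\<lambda>i. cell A (x i)) n"
      have r: "?r n > 0" for n using elim(1) by blast
      have m: "MM.wp (word n x) > 0" for n
        unfolding MM_wp_word using elim(2) by (intro prod_pos) auto
      have npd: "npd R n x = ?r n / MM.wp (word n x)" for n
        by (simp add: npd_def MM_wp_word prod_int_interval)
      have "log 2 (npd R n x) / real n = - (- log 2 (?r n) / real n) - (\<Sum>k<n. b (shift_by k x)) / real n" for n
        using r[of n] m[of n] elim(3) unfolding npd by (simp add: log_divide diff_divide_distrib)
      moreover have "(\<lambda>n. - (- log 2 (?r n) / real n) - (\<Sum>k<n. b (shift_by k x)) / real n) \<longlonglongrightarrow> d"
        unfolding d_def by (intro tendsto_diff tendsto_minus elim(4)) (use elim(1) in blast)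
      ultimately show ?case
        using r m by (simp add: npd)
    qed
    fix n :: nat and G :: "real set list \<Rightarrow> real" assume n: "n \<ge> 1"
    \<comment> \<open>\<open>?q\<close> is the \<open>M\<close>-law of words tilted by
      \<open>G\<close>, left unnormalized; its total mass is the \<open>M\<close>-integral of
      \<open>2 powr G\<close>.\<close>
    let ?p = PP.wp and ?q = "\<lambda>w. MM.wp w * 2 powr G w"
    have "(\<Sum>w\<in>words n. ?p w * log 2 (?q w)) = (\<Sum>w\<in>words n. ?p w * log 2 (MM.wp w) + ?p w * G w)"
    proof (rule sum.cong)
      fix w assume w: "w \<in> words n"
      show "?p w * log 2 (?q w) = ?p w * log 2 (MM.wp w) + ?p w * G w"
        using MM_wp_pos[OF w] PP.wp_nonneg[of w]
        by (cases "?p w = 0") (auto simp: log_mult less_le distrib_left)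
    qed simp
    also have "\<dots> = (\<integral>x. log 2 (MM.wp (word n x)) \<partial>P) + (\<integral>x. G (word n x) \<partial>P)"
      unfolding sum.distrib PP.integral_word[symmetric, of _ n] PP.integral_word[symmetric, of "\<lambda>w. log 2 (MM.wp w)" n] ..
    also have "(\<integral>x. log 2 (MM.wp (word n x)) \<partial>P) = (\<integral>x. (\<Sum>k<n. b (shift_by k x)) \<partial>P)"
    proof (rule integral_cong_AE)
      show "(\<lambda>x. log 2 (MM.wp (word n x))) \<in> borel_measurable P"
        using PP.integrable_word[of "\<lambda>w. log 2 (MM.wp w)" n] by auto
      show "(\<lambda>x. \<Sum>k<n. b (shift_by k x)) \<in> borel_measurable P"
        using integrable_shift_by[OF b_int] by auto
      show "AE x in P. log 2 (MM.wp (word n x)) = (\<Sum>k<n. b (shift_by k x))"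
        using b_sum by eventually_elim auto
    qed
    also have "\<dots> = real n * (\<integral>x. b x \<partial>P)"
      using integrable_shift_by[OF b_int] integral_shift_by[OF b_int] by (simp add: Bochner_Integration.integral_sum)
    finally have "(\<Sum>w\<in>words n. ?p w * log 2 (?q w)) = real n * (\<integral>x. b x \<partial>P) + (\<integral>x. G (word n x) \<partial>P)" .
    moreover have "(\<Sum>w\<in>words n. ?q w) = (\<integral>x. 2 powr G (word n x) \<partial>M)"
      using MM.integral_word[of "\<lambda>w. 2 powr G w" n] by simp
    moreover have "(\<Sum>w\<in>words n. ?p w * log 2 (?p w)) = - block_entropy Q A n"
      by (simp add: block_entropy_Q)
    moreover have "real n * H \<le> block_entropy Q A n"
      using H_le[OF n] n by (simp add: field_simps)
    ultimately show "(\<integral>x. G (word n x) \<partial>P) - ((\<integral>x. 2 powr G (word n x) \<partial>M) - 1) / ln 2 \<le> real n * d"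
      using finite_gibbs[of "words n" ?p ?q] MM_wp_pos PP.sum_wp[of n]
      by (simp add: d_def right_diff_distrib)
  qed
qed

end

section \<open>Cellwise approximation\<close>

locale refining_partitions =
  fixes Ch :: "nat \<Rightarrow> real set set"
  assumes nested: "nested_partitions Ch"
begin

sublocale part: finite_partition "Ch l" for l
  using nested unfolding nested_partitions_def by unfold_locales blast+

text \<open>Measurability with respect to the level-\<open>l\<close> cells of the block, stated
  pointwise; as there are finitely many cells, it amounts to being a function of the word.\<close>

definition cellwise :: "nat \<Rightarrow> nat \<Rightarrow> ((int \<Rightarrow> real) \<Rightarrow> real) \<Rightarrow> bool" where
  "cellwise n l g \<longleftrightarrow> (\<forall>x y. (\<forall>i\<in>{1..int n}. cell (Ch l) (x i) = cell (Ch l) (y i)) \<longrightarrow> g x = g y)"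

lemma cellwise_const: "cellwise n l (\<lambda>x. c)"
  by (simp add: cellwise_def)

lemma cellwise_comp: "cellwise n l g \<Longrightarrow> cellwise n l (\<lambda>x. F (g x))"
  unfolding cellwise_def by metis

lemma cellwise_comp2: "cellwise n l g \<Longrightarrow> cellwise n l h \<Longrightarrow> cellwise n l (\<lambda>x. F (g x) (h x))"
  unfolding cellwise_def by metis

text \<open>Nesting is given for the generated sigma-fields; a coarse cell lies in the finer field
  and is therefore saturated with respect to the fine cells.\<close>

lemma cell_mono:
  assumes "l \<le> l'" "cell (Ch l') v = cell (Ch l') v'"
  shows "cell (Ch l) v = cell (Ch l) v'"
proof -
  have "sigma_sets UNIV (Ch l) \<subseteq> sigma_sets UNIV (Ch l')"
    using assms(1) by (rule lift_Suc_mono_le[rotated]) (use nested in \<open>simp add: nested_partitions_def\<close>)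
  then have "cell (Ch l) v \<in> sigma_sets UNIV (Ch l')" by auto
  from part.sigma_sets_saturated[OF this assms(2)] have "v' \<in> cell (Ch l) v"
    using part.in_cell by blast
  then show ?thesis using part.cell_eq[OF part.cell_in] by metis
qed

lemma cellwise_mono: "cellwise n l g \<Longrightarrow> l \<le> l' \<Longrightarrow> cellwise n l' g"
proof -
  assume g: "cellwise n l g" and le: "l \<le> l'"
  show ?thesis
    unfolding cellwise_def
  proof (intro allI impI)
    fix x y assume eq: "\<forall>i\<in>{1..int n}. cell (Ch l') (x i) = cell (Ch l') (y i)"
    have "\<forall>i\<in>{1..int n}. cell (Ch l) (x i) = cell (Ch l) (y i)"
      by (intro ballI cell_mono[OF le] bspec[OF eq])
    then show "g x = g y" by (rule g[unfolded cellwise_def, THEN spec, THEN spec, THEN mp])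
  qed
qed

lemma cellwise_obtain:
  assumes "cellwise n l g"
  obtains G where "g = (\<lambda>x. G (part.word l n x))"
proof
  show "g = (\<lambda>x. g (SOME y. part.word l n y = part.word l n x))"
  proof
    fix x
    define y where "y = (SOME y. part.word l n y = part.word l n x)"
    have "part.word l n y = part.word l n x"
      unfolding y_def by (rule someI[of _ x]) simp
    then have "g y = g x"
      using assms unfolding cellwise_def part.word_eq_word_iff by blast
    then show "g x = g (SOME y. part.word l n y = part.word l n x)"
      unfolding y_def by simp
  qed
qed

lemma cellwise_measurable: "cellwise n l g \<Longrightarrow> {1..int n} \<subseteq> I \<Longrightarrow> g \<in> borel_measurable (\<Pi>\<^sub>M i\<in>I. borel)"
proof -
  assume g: "cellwise n l g" and I: "{1..int n} \<subseteq> I"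
  obtain G where g: "g = (\<lambda>x. G (part.word l n x))" using cellwise_obtain[OF g] .
  show ?thesis unfolding g by (rule part.word_function_measurable[OF I])
qed

lemma cellwise_bounded:
  assumes "cellwise n l g"
  obtains B where "\<And>x. \<bar>g x\<bar> \<le> B"
proof -
  obtain G where g: "g = (\<lambda>x. G (part.word l n x))" using cellwise_obtain[OF assms] .
  have "\<bar>g x\<bar> \<le> (\<Sum>w\<in>part.words l n. \<bar>G w\<bar>)" for x
    unfolding g by (rule member_le_sum[where f="\<lambda>w. \<bar>G w\<bar>"]) auto
  then show ?thesis using that by blast
qed

end

section \<open>Cellwise functions are dense in L1 of a finite measure on a block\<close>

locale block_measure = refining_partitions Ch + finite_measure N
  for Ch :: "nat \<Rightarrow> real set set" and N :: "(int \<Rightarrow> real) measure" +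
  fixes n :: nat
  assumes sets_N [measurable_cong]: "sets N = sets (\<Pi>\<^sub>M i\<in>{1..int n}. borel)"
begin

lemma space_N: "space N = {1..int n} \<rightarrow>\<^sub>E UNIV"
  using sets_eq_imp_space_eq[OF sets_N] by (simp add: space_PiM)

lemma cellwise_integrable: "cellwise n l g \<Longrightarrow> integrable N g"
proof -
  assume g: "cellwise n l g"
  have "g \<in> borel_measurable N"
    using cellwise_measurable[OF g subset_refl] by (simp add: measurable_cong_sets[OF sets_N refl])
  moreover obtain B where "\<And>x. \<bar>g x\<bar> \<le> B" using cellwise_bounded[OF g] by blast
  ultimately show ?thesis
    by (intro integrable_const_bound[where B=B]) auto
qed

text \<open>Membership in the L1 closure of the cellwise functions of all levels together.\<close>

definition approximable :: "((int \<Rightarrow> real) \<Rightarrow> real) \<Rightarrow> bool" where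
  "approximable h \<longleftrightarrow> integrable N h \<and> (\<forall>\<epsilon>>0. \<exists>l g. cellwise n l g \<and> (\<integral>x. \<bar>h x - g x\<bar> \<partial>N) < \<epsilon>)"

lemma approximable_integrable: "approximable h \<Longrightarrow> integrable N h"
  by (simp add: approximable_def)

lemma approximableE:
  assumes "approximable h" "\<epsilon> > 0"
  obtains l g where "cellwise n l g" "(\<integral>x. \<bar>h x - g x\<bar> \<partial>N) < \<epsilon>"
  using assms by (auto simp: approximable_def)

lemma approximable_cellwise: "cellwise n l g \<Longrightarrow> approximable g"
  unfolding approximable_def by (auto intro!: cellwise_integrable exI[of _ l] exI[of _ g])

lemma approximable_cong:
  assumes "approximable h" "\<And>x. x \<in> space N \<Longrightarrow> h x = h' x"
  shows "approximable h'"
proof -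
  have "integrable N h' = integrable N h" "(\<integral>x. \<bar>h' x - g x\<bar> \<partial>N) = (\<integral>x. \<bar>h x - g x\<bar> \<partial>N)" for g
    using assms(2) by (auto intro!: Bochner_Integration.integrable_cong Bochner_Integration.integral_cong)
  then show ?thesis using assms(1) by (simp add: approximable_def)
qed

text \<open>One closure property for complements, maxima, sums and scalar multiples. Two
  approximants combine at the finer of their levels, and the L1 error grows by at most the Lipschitz
  constant.\<close>

lemma approximable_lipschitz:
  assumes h: "approximable h" "approximable h'" and meas: "(\<lambda>x. F (h x) (h' x)) \<in> borel_measurable N"
    and F: "\<And>a b a' b'. \<bar>F a b - F a' b'\<bar> \<le> C * (\<bar>a - a'\<bar> + \<bar>b - b'\<bar>)" and C: "C > 0"
  shows "approximable (\<lambda>x. F (h x) (h' x))"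
proof -
  note hi = approximable_integrable[OF h(1)] approximable_integrable[OF h(2)]
  have "\<bar>F (h x) (h' x)\<bar> \<le> \<bar>F 0 0\<bar> + C * (\<bar>h x\<bar> + \<bar>h' x\<bar>)" for x
    using F[of "h x" "h' x" 0 0] by simp
  note F_bound = order_trans[OF this abs_ge_self]
  have int: "integrable N (\<lambda>x. F (h x) (h' x))"
  proof (rule Bochner_Integration.integrable_bound[OF _ meas])
    show "integrable N (\<lambda>x. \<bar>F 0 0\<bar> + C * (\<bar>h x\<bar> + \<bar>h' x\<bar>))" using hi by simp
    show "AE x in N. norm (F (h x) (h' x)) \<le> norm (\<bar>F 0 0\<bar> + C * (\<bar>h x\<bar> + \<bar>h' x\<bar>))"
      unfolding real_norm_def by (intro AE_I2 F_bound)
  qed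
  show ?thesis
    unfolding approximable_def
  proof (intro conjI int allI impI)
    fix \<epsilon> :: real assume e: "\<epsilon> > 0"
    then have e': "\<epsilon> / (2 * C) > 0" using C by simp
    obtain l g where g: "cellwise n l g" "(\<integral>x. \<bar>h x - g x\<bar> \<partial>N) < \<epsilon> / (2 * C)"
      using approximableE[OF h(1) e'] .
    obtain l' g' where g': "cellwise n l' g'" "(\<integral>x. \<bar>h' x - g' x\<bar> \<partial>N) < \<epsilon> / (2 * C)"
      using approximableE[OF h(2) e'] .
    have cw: "cellwise n (max l l') (\<lambda>x. F (g x) (g' x))"
      by (rule cellwise_comp2[OF cellwise_mono[OF g(1)] cellwise_mono[OF g'(1)]]) auto
    note gi = cellwise_integrable[OF g(1)] cellwise_integrable[OF g'(1)]
    have "(\<integral>x. \<bar>F (h x) (h' x) - F (g x) (g' x)\<bar> \<partial>N) \<le> (\<integral>x. C * (\<bar>h x - g x\<bar> + \<bar>h' x - g' x\<bar>) \<partial>N)"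
      by (intro integral_mono F) (use int cellwise_integrable[OF cw] gi hi in auto)
    also have "\<dots> = C * ((\<integral>x. \<bar>h x - g x\<bar> \<partial>N) + (\<integral>x. \<bar>h' x - g' x\<bar> \<partial>N))"
      using gi hi by simp
    also have "\<dots> < C * (\<epsilon> / (2 * C) + \<epsilon> / (2 * C))"
      using C g g' by (intro mult_strict_left_mono add_strict_mono) auto
    also have "\<dots> = \<epsilon>" using C by (simp add: field_simps)
    finally show "\<exists>l k. cellwise n l k \<and> (\<integral>x. \<bar>F (h x) (h' x) - k x\<bar> \<partial>N) < \<epsilon>"
      using cw by blast
  qed
qed

lemma approximable_limit:
  assumes s: "\<And>i. approximable (s i)" and meas: "h \<in> borel_measurable N"
    and lim: "\<And>x. x \<in> space N \<Longrightarrow> (\<lambda>i. s i x) \<longlonglongrightarrow> h x"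
    and bound: "\<And>i x. x \<in> space N \<Longrightarrow> \<bar>s i x\<bar> \<le> w x" and w: "integrable N w"
  shows "approximable h"
proof -
  have int: "integrable N h"
    by (rule integrable_dominated_convergence[where s=s and w=w])
       (use assms approximable_integrable[OF s] in auto)
  have "(\<lambda>i. \<integral>x. \<bar>h x - s i x\<bar> \<partial>N) \<longlonglongrightarrow> (\<integral>x. 0 \<partial>N)"
  proof (rule integral_dominated_convergence[where w="\<lambda>x. \<bar>h x\<bar> + w x"])
    show "AE x in N. (\<lambda>i. \<bar>h x - s i x\<bar>) \<longlonglongrightarrow> 0"
    proof (rule AE_I2)
      fix x assume "x \<in> space N"
      then have "(\<lambda>i. \<bar>h x - s i x\<bar>) \<longlonglongrightarrow> \<bar>h x - h x\<bar>" by (intro tendsto_intros lim)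
      then show "(\<lambda>i. \<bar>h x - s i x\<bar>) \<longlonglongrightarrow> 0" by simp
    qed
    fix i show "AE x in N. norm \<bar>h x - s i x\<bar> \<le> \<bar>h x\<bar> + w x"
    proof (rule AE_I2)
      fix x assume "x \<in> space N"
      from bound[OF this, of i] show "norm \<bar>h x - s i x\<bar> \<le> \<bar>h x\<bar> + w x" by simp
    qed
  qed (use int w approximable_integrable[OF s] in auto)
  then have lim0: "(\<lambda>i. \<integral>x. \<bar>h x - s i x\<bar> \<partial>N) \<longlonglongrightarrow> 0" by simp
  show ?thesis
    unfolding approximable_def
  proof (intro conjI int allI impI)
    fix \<epsilon> :: real assume e: "\<epsilon> > 0"
    then have "\<forall>\<^sub>F i in sequentially. (\<integral>x. \<bar>h x - s i x\<bar> \<partial>N) < \<epsilon> / 2"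
      by (intro order_tendstoD[OF lim0]) auto
    then obtain i where i: "(\<integral>x. \<bar>h x - s i x\<bar> \<partial>N) < \<epsilon> / 2"
      by (auto simp: eventually_sequentially)
    obtain l g where g: "cellwise n l g" "(\<integral>x. \<bar>s i x - g x\<bar> \<partial>N) < \<epsilon> / 2"
      using approximableE[OF s[of i], of "\<epsilon> / 2"] e by auto
    note ints = int approximable_integrable[OF s[of i]] cellwise_integrable[OF g(1)]
    have "(\<integral>x. \<bar>h x - g x\<bar> \<partial>N) \<le> (\<integral>x. \<bar>h x - s i x\<bar> + \<bar>s i x - g x\<bar> \<partial>N)"
      by (rule integral_mono) (use ints in auto)
    also have "\<dots> = (\<integral>x. \<bar>h x - s i x\<bar> \<partial>N) + (\<integral>x. \<bar>s i x - g x\<bar> \<partial>N)"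
      using ints by simp
    finally show "\<exists>l g. cellwise n l g \<and> (\<integral>x. \<bar>h x - g x\<bar> \<partial>N) < \<epsilon>"
      using g i by (intro exI[of _ l] exI[of _ g]) auto
  qed
qed

lemma approximable_compl:
  assumes "approximable (indicator S)" and S: "S \<in> sets N"
  shows "approximable (indicator (space N - S))"
proof (rule approximable_cong)
  show "approximable (\<lambda>x. 1 - indicator S x)"
    by (rule approximable_lipschitz[OF assms(1) assms(1), where F="\<lambda>a b. 1 - a" and C=1]) (use S in auto)
qed (auto split: split_indicator)

text \<open>Finite unions come from maxima of indicators; the countable union is their limit,
  dominated by 1, which is integrable because \<open>N\<close> is finite.\<close>

lemma approximable_union:
  assumes "\<And>i::nat. approximable (indicator (S i))" and S: "\<And>i. S i \<in> sets N"
  shows "approximable (indicator (\<Union>i. S i))"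
proof -
  have fin: "approximable (indicator (\<Union>i<k. S i))" for k
  proof (induction k)
    case 0
    show ?case using approximable_cellwise[OF cellwise_const[of n 0 0]] by (rule approximable_cong) auto
  next
    case (Suc k)
    show ?case
    proof (rule approximable_cong)
      show "approximable (\<lambda>x. max (indicator (\<Union>i<k. S i) x) (indicator (S k) x))"
        by (rule approximable_lipschitz[OF Suc assms(1), where F=max and C=1]) (use S in auto)
    qed (auto simp: lessThan_Suc split: split_indicator)
  qed
  show ?thesis
  proof (rule approximable_limit[OF fin])
    show "indicator (\<Union>i. S i) \<in> borel_measurable N" using S by auto
    show "(\<lambda>i. indicator (\<Union>i<i. S i) x) \<longlonglongrightarrow> (indicator (\<Union>i. S i) x :: real)" for x
      by (rule LIMSEQ_indicator_UN)
    show "integrable N (\<lambda>x. 1)" by simp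
  qed (auto split: split_indicator)
qed

text \<open>Here the partitions generating the Borel sets matter: a set from some level is cellwise,
  and the induction over the generated sigma-field does the rest.\<close>

lemma approximable_coordinate:
  assumes i: "i \<in> {1..int n}" and B: "B \<in> sets borel"
  shows "approximable (indicator {x \<in> space N. x i \<in> B})"
proof -
  have m: "{x \<in> space N. x i \<in> B} \<in> sets N" if "B \<in> sets borel" for B
    using i that by measurable
  have b: "sets borel = sigma_sets UNIV (\<Union>l. sigma_sets UNIV (Ch l))"
    using nested by (simp add: nested_partitions_def)
  show ?thesis
    using B unfolding b
  proof induction
    case (Basic C)
    then obtain l where l: "C \<in> sigma_sets UNIV (Ch l)" by auto
    have "approximable (\<lambda>x. indicator C (x i))"
    proof (rule approximable_cellwise)
      show "cellwise n l (\<lambda>x. indicator C (x i))"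
        unfolding cellwise_def
      proof (intro allI impI)
        fix x y assume "\<forall>i\<in>{1..int n}. cell (Ch l) (x i) = cell (Ch l) (y i)"
        with i have "cell (Ch l) (x i) = cell (Ch l) (y i)" by blast
        from part.sigma_sets_saturated[OF l this] show "indicator C (x i) = (indicator C (y i) :: real)"
          by (simp add: indicator_def)
      qed
    qed
    then show ?case by (rule approximable_cong) (auto split: split_indicator)
  next
    case Empty
    show ?case using approximable_cellwise[OF cellwise_const[of n 0 0]] by (rule approximable_cong) auto
  next
    case (Compl C)
    have "space N - {x \<in> space N. x i \<in> C} = {x \<in> space N. x i \<in> UNIV - C}" by auto
    then show ?case
      using approximable_compl[OF Compl.IH m] Compl.hyps b by simp
  next
    case (Union C)
    have "(\<Union>j. {x \<in> space N. x i \<in> C j}) = {x \<in> space N. x i \<in> \<Union>(range C)}" by auto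
    then show ?case
      using approximable_union[of "\<lambda>j. {x \<in> space N. x i \<in> C j}"] Union m b by simp
  qed
qed

text \<open>Approximable sets form a sigma-field, so the coordinate events, which generate the
  product sigma-field, suffice.\<close>

lemma approximable_set:
  assumes "S \<in> sets N"
  shows "approximable (indicator S)"
proof -
  have s: "sets N = sigma_sets (space N) {{x \<in> space N. x i \<in> B} | i B. i \<in> {1..int n} \<and> B \<in> sets borel}"
    unfolding sets_N sets_PiM_single space_N by simp
  show ?thesis
    using assms unfolding s
  proof induction
    case (Basic C)
    then show ?case using approximable_coordinate by auto
  next
    case Empty
    show ?case using approximable_cellwise[OF cellwise_const[of n 0 0]] by (rule approximable_cong) auto
  next
    case (Compl C)
    then show ?case using approximable_compl s by simp
  next
    case (Union C)
    then show ?case using approximable_union[of C] s by simp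
  qed
qed

lemma integrable_approximable:
  assumes "integrable N h"
  shows "approximable h"
  using assms
proof (induction rule: integrable_induct)
  case (base S c)
  have "approximable (\<lambda>x. indicator S x * c)"
  proof (rule approximable_lipschitz[OF approximable_set approximable_set, where F="\<lambda>a b. a * c" and C="\<bar>c\<bar> + 1"])
    show "\<bar>a * c - a' * c\<bar> \<le> (\<bar>c\<bar> + 1) * (\<bar>a - a'\<bar> + \<bar>b - b'\<bar>)" for a b a' b' :: real
    proof -
      have "\<bar>a * c - a' * c\<bar> = \<bar>c\<bar> * \<bar>a - a'\<bar>" by (simp add: abs_mult[symmetric] algebra_simps)
      also have "\<dots> \<le> (\<bar>c\<bar> + 1) * (\<bar>a - a'\<bar> + \<bar>b - b'\<bar>)" by (intro mult_mono) auto
      finally show ?thesis .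
    qed
  qed (use base in auto)
  then show ?case by simp
next
  case (add f g)
  show ?case
    by (rule approximable_lipschitz[OF add.IH, where F="(+)" and C=1]) (use add.hyps in auto)
next
  case (lim f s)
  show ?case
    by (rule approximable_limit[of s _ "\<lambda>x. 2 * norm (f x)"]) (use lim in auto)
qed

text \<open>The bound on \<open>g\<close> is what \<open>powr_2_lipschitz\<close> later asks for.
  Clamping to \<open>[-K, K]\<close>, where \<open>h\<close> takes its values, keeps an approximant
  cellwise and does not increase the error.\<close>

lemma bounded_approximation:
  assumes h: "h \<in> borel_measurable N" "\<And>x. \<bar>h x\<bar> \<le> K" and e: "\<epsilon> > 0"
  obtains l g where "cellwise n l g" "\<And>x. \<bar>g x\<bar> \<le> K" "(\<integral>\<^sup>+x. ennreal \<bar>h x - g x\<bar> \<partial>N) < ennreal \<epsilon>"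
proof -
  have hi: "integrable N h" by (intro integrable_const_bound[where B=K]) (use h in auto)
  obtain l g where g: "cellwise n l g" "(\<integral>x. \<bar>h x - g x\<bar> \<partial>N) < \<epsilon>"
    using approximableE[OF integrable_approximable[OF hi] e] .
  let ?g = "\<lambda>x. max (- K) (min K (g x))"
  have cw: "cellwise n l ?g" by (rule cellwise_comp[OF g(1)])
  have int: "integrable N (\<lambda>x. \<bar>h x - ?g x\<bar>)" using hi cellwise_integrable[OF cw] by auto
  have "(\<integral>x. \<bar>h x - ?g x\<bar> \<partial>N) \<le> (\<integral>x. \<bar>h x - g x\<bar> \<partial>N)"
  proof (rule integral_mono[OF int])
    show "\<bar>h x - ?g x\<bar> \<le> \<bar>h x - g x\<bar>" for x using h(2)[of x] by linarith
  qed (use hi cellwise_integrable[OF g(1)] in auto)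
  then have "(\<integral>\<^sup>+x. ennreal \<bar>h x - ?g x\<bar> \<partial>N) < ennreal \<epsilon>"
    using nn_integral_eq_integral[OF int] g(2) e by (simp add: ennreal_less_iff)
  moreover have "\<bar>?g x\<bar> \<le> K" for x using h(2)[of x] by auto
  ultimately show ?thesis using that[OF cw] by blast
qed

end

section \<open>The NPD mixture\<close>

text \<open>On numbers up to \<open>K\<close> the function \<open>2 powr\<close> has slope at most
  \<open>2 powr K * ln 2\<close>; the case \<open>b \<le> a\<close> comes down to
  \<open>1 - exp (- y) \<le> y\<close>.\<close>

lemma powr_2_lipschitz:
  fixes a b K :: real
  assumes "a \<le> K" "b \<le> K"
  shows "2 powr a \<le> 2 powr b + 2 powr K * ln 2 * \<bar>a - b\<bar>"
proof (cases "b \<le> a")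
  case True
  have "1 - exp (- ((a - b) * ln 2)) \<le> (a - b) * ln 2"
    using exp_ge_add_one_self[of "- ((a - b) * ln 2)"] by simp
  moreover have "exp (- ((a - b) * ln 2)) = 2 powr (b - a)" by (simp add: powr_def algebra_simps)
  ultimately have "2 powr a * (1 - 2 powr (b - a)) \<le> 2 powr a * ((a - b) * ln 2)"
    by (intro mult_left_mono) auto
  also have "\<dots> \<le> 2 powr K * ((a - b) * ln 2)"
    using assms True by (intro mult_right_mono) auto
  also have "2 powr a * (1 - 2 powr (b - a)) = 2 powr a - 2 powr b"
    by (simp add: right_diff_distrib powr_add[symmetric])
  finally show ?thesis using True by (simp add: algebra_simps)
next
  case False
  then have "2 powr a \<le> 2 powr b" by simp
  then show ?thesis by (smt (verit) mult_nonneg_nonneg powr_ge_zero ln_ge_zero abs_ge_zero)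
qed

locale npd_process = dominated_process P \<mu> f D + refining_partitions Ch
  for P :: "(int \<Rightarrow> real) measure" and \<mu> :: "real measure" and f :: "nat \<Rightarrow> (int \<Rightarrow> real) \<Rightarrow> real" and D :: real
    and Ch :: "nat \<Rightarrow> real set set"
begin

text \<open>The \<open>P\<close>-probability of a block event is the \<open>M\<close>-integral of
  \<open>f n\<close> over it, so null events of a block carry over.\<close>

lemma AE_block_transfer:
  assumes m: "{x. Q x} \<in> sets (\<Pi>\<^sub>M i\<in>(UNIV :: int set). borel)" and b: "depends_on_block n Q"
    and ae: "AE x in M. Q x"
  shows "AE x in P. Q x"
proof -
  have [measurable]: "{x. Q x} \<in> sets (\<Pi>\<^sub>M i\<in>(UNIV :: int set). borel)" by (rule m)
  have "(\<integral>\<^sup>+x. indicator (- {x. Q x}) x \<partial>P) = (\<integral>\<^sup>+x. indicator (- {x. Q x}) x * ennreal (f n x) \<partial>M)"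
  proof (rule f_density)
    have "- {x. Q x} \<in> sets (\<Pi>\<^sub>M i\<in>(UNIV :: int set). borel)"
      using sets.compl_sets[OF m] by (simp add: space_PiM PiE_UNIV_domain Compl_eq_Diff_UNIV)
    then show "(indicator (- {x. Q x}) :: _ \<Rightarrow> ennreal) \<in> borel_measurable (\<Pi>\<^sub>M i\<in>(UNIV :: int set). borel)"
      by measurable
    show "depends_on_block n (indicator (- {x. Q x}) :: _ \<Rightarrow> ennreal)"
      using depends_on_block_comp[OF b, of "\<lambda>q. of_bool (\<not> q)"] by (simp add: indicator_def[abs_def])
  qed
  also have "\<dots> = (\<integral>\<^sup>+x. 0 \<partial>M)"
    by (rule nn_integral_cong_AE) (use ae in \<open>eventually_elim, auto\<close>)
  finally have 0: "(\<integral>\<^sup>+x. indicator (- {x. Q x}) x \<partial>P) = (0 :: ennreal)" by simp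
  have c: "- {x. Q x} \<in> events"
    using sets.compl_sets[OF m] by (simp add: space_PiM PiE_UNIV_domain Compl_eq_Diff_UNIV sets_P)
  have "emeasure P (- {x. Q x}) = 0" using 0 c by simp
  then show ?thesis
    using c by (subst AE_iff_measurable[of "- {x. Q x}"]) (auto simp: Compl_eq)
qed

lemma null_cells: "c \<in> sets borel \<Longrightarrow> measure \<mu> c = 0 \<Longrightarrow> AE x in P. x 1 \<notin> c"
proof (rule AE_block_transfer[where n=1])
  assume c [measurable]: "c \<in> sets borel" and 0: "measure \<mu> c = 0"
  have "{x \<in> space (\<Pi>\<^sub>M i\<in>(UNIV :: int set). borel). x 1 \<notin> c} \<in> sets (\<Pi>\<^sub>M i\<in>(UNIV :: int set). borel)" by measurable
  then show "{x. x 1 \<notin> c} \<in> sets (\<Pi>\<^sub>M i\<in>(UNIV :: int set). borel)" by (simp add: space_PiM PiE_UNIV_domain)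
  show "depends_on_block 1 (\<lambda>x. x 1 \<notin> c)" by (auto simp: depends_on_block_def)
  have "AE y in \<mu>. y \<notin> c"
    by (rule AE_not_in) (use 0 c sets_mu in \<open>auto simp: null_sets_def product.M.emeasure_eq_measure\<close>)
  then show "AE x in M. x 1 \<notin> c"
    unfolding M_def by (intro AE_PiM_component) (auto intro: prob_space_mu)
qed

sublocale q: quantized_process P \<mu> "Ch l" for l
  by unfold_locales (auto intro: null_cells part.A_borel)

lemma f_integral_M: "(\<integral>\<^sup>+x. ennreal (f n x) \<partial>M) = 1"
  using f_density[of "\<lambda>x. 1" n] emeasure_space_1 by (simp add: depends_on_block_const)

text \<open>The optimal function in the Donsker-Varadhan inequality is \<open>log 2 (f n)\<close>,
  whose exponential integrates to 1 under \<open>M\<close>. It is first made bounded, to control the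
  exponential term, and then replaced by a function of cells.\<close>

lemma cellwise_relative_entropy:
  assumes "\<delta> > 0"
  shows "\<exists>l G. (\<integral>x. log 2 (f n x) \<partial>P) - \<delta> \<le>
     (\<integral>x. G (part.word l n x) \<partial>P) - ((\<integral>x. 2 powr G (part.word l n x) \<partial>M) - 1) / ln 2"
proof -
  let ?L = "\<lambda>x. log 2 (f n x)"
  have [measurable]: "f n \<in> borel_measurable P" "f n \<in> borel_measurable M" by measurable
  have "(\<lambda>K. \<integral>x. min (real K) (?L x) \<partial>P) \<longlonglongrightarrow> (\<integral>x. ?L x \<partial>P)"
  proof (rule integral_dominated_convergence[where w="\<lambda>x. \<bar>?L x\<bar>"])
    show "AE x in P. (\<lambda>K. min (real K) (?L x)) \<longlonglongrightarrow> ?L x"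
    proof (rule AE_I2)
      fix x
      obtain K0 :: nat where "?L x \<le> real K0" using real_arch_simple by blast
      then have "\<forall>\<^sub>F K in sequentially. min (real K) (?L x) = ?L x"
        unfolding eventually_sequentially by (intro exI[of _ K0]) auto
      then show "(\<lambda>K. min (real K) (?L x)) \<longlonglongrightarrow> ?L x" by (rule tendsto_eventually)
    qed
  qed (use f_log_integrable[of n] in auto)
  then have "\<forall>\<^sub>F K in sequentially. (\<integral>x. min (real K) (?L x) \<partial>P) > (\<integral>x. ?L x \<partial>P) - \<delta> / 4"
    by (rule order_tendstoD) (use assms in auto)
  moreover have "\<forall>\<^sub>F K in sequentially. 2 powr (- real K) / ln 2 < \<delta> / 4"
  proof (rule order_tendstoD)
    show "(\<lambda>K. 2 powr (- real K) / ln 2) \<longlonglongrightarrow> 0" by real_asymp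
  qed (use assms in auto)
  ultimately have "\<forall>\<^sub>F K in sequentially. (\<integral>x. min (real K) (?L x) \<partial>P) > (\<integral>x. ?L x \<partial>P) - \<delta> / 4 \<and>
      2 powr (- real K) / ln 2 < \<delta> / 4"
    by eventually_elim auto
  then obtain K :: nat where K: "(\<integral>x. min (real K) (?L x) \<partial>P) > (\<integral>x. ?L x \<partial>P) - \<delta> / 4"
      "2 powr (- real K) / ln 2 < \<delta> / 4"
    by (auto simp: eventually_sequentially)
  \<comment> \<open>Capped at \<open>K\<close>, and kept above \<open>- K\<close> by the summand
    inside the logarithm. That summand only raises \<open>g\<close>, so the lower bound on the mean
    survives, while \<open>2 powr g\<close> exceeds \<open>f n\<close> by at most
    \<open>2 powr (- K)\<close>.\<close>
  define g where "g x = min (real K) (log 2 (f n x + 2 powr (- real K)))" for x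
  have g_meas [measurable]: "g \<in> borel_measurable (\<Pi>\<^sub>M i\<in>UNIV. borel)" unfolding g_def by measurable
  have g_block: "depends_on_block n g" unfolding g_def[abs_def] by (rule depends_on_block_comp[OF f_block])
  have pos: "f n x + 2 powr (- real K) > 0" for x using f_nonneg[of n x] by (simp add: add_nonneg_pos)
  have g_bound: "\<bar>g x\<bar> \<le> real K" for x
  proof -
    have "- real K \<le> log 2 (f n x + 2 powr (- real K))"
      using f_nonneg[of n x] pos by (simp add: le_log_iff)
    then show ?thesis by (auto simp: g_def)
  qed
  have g_powr: "2 powr g x \<le> f n x + 2 powr (- real K)" for x
  proof -
    have "2 powr g x \<le> 2 powr (log 2 (f n x + 2 powr (- real K)))" by (simp add: g_def)
    then show ?thesis using pos by simp
  qed
  have g_ge: "AE x in P. min (real K) (?L x) \<le> g x"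
    using f_pos[of n]
  proof eventually_elim
    case (elim x)
    then have "?L x \<le> log 2 (f n x + 2 powr (- real K))" using pos[of x] by simp
    then show ?case unfolding g_def by linarith
  qed
  \<comment> \<open>The approximation costs \<open>\<epsilon>\<close> under \<open>P\<close> and
    \<open>2 powr K * \<epsilon>\<close> in the exponential term under \<open>M\<close>, together
    \<open>\<delta> / 4\<close>; capping and the summand \<open>2 powr (- K)\<close> cost at most
    \<open>\<delta> / 4\<close> each.\<close>
  define \<epsilon> where "\<epsilon> = \<delta> / (4 * (1 + 2 powr real K))"
  have e: "\<epsilon> > 0" using assms by (auto simp: \<epsilon>_def intro!: divide_pos_pos mult_pos_pos add_pos_pos)
  let ?I = "{1..int n}"
  \<comment> \<open>On functions of the block \<open>\<nu>\<close> acts as \<open>M + P\<close>, so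
    a single L1 approximation controls the error under both measures.\<close>
  define \<nu> where "\<nu> = density M (\<lambda>x. 1 + ennreal (f n x))"
  define N where "N = distr \<nu> (\<Pi>\<^sub>M i\<in>?I. borel) (\<lambda>x. restrict x ?I)"
  have [measurable_cong]: "sets \<nu> = sets (\<Pi>\<^sub>M i\<in>UNIV. borel)" by (simp add: \<nu>_def sets_M)
  have restr [measurable]: "(\<lambda>x. restrict x ?I) \<in> \<nu> \<rightarrow>\<^sub>M (\<Pi>\<^sub>M i\<in>?I. borel)"
    unfolding measurable_cong_sets[OF \<open>sets \<nu> = sets (\<Pi>\<^sub>M i\<in>UNIV. borel)\<close> refl] by (rule measurable_restrict_subset) auto
  have N_integral: "(\<integral>\<^sup>+x. F x \<partial>N) = (\<integral>\<^sup>+x. F (restrict x ?I) \<partial>M) + (\<integral>\<^sup>+x. F (restrict x ?I) * ennreal (f n x) \<partial>M)"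
    if F [measurable]: "F \<in> borel_measurable (\<Pi>\<^sub>M i\<in>?I. borel)" for F
  proof -
    have [measurable]: "(\<lambda>x. F (restrict x ?I)) \<in> borel_measurable M"
      using measurable_compose[OF restr F] by (simp add: \<nu>_def)
    have "(\<integral>\<^sup>+x. F x \<partial>N) = (\<integral>\<^sup>+x. F (restrict x ?I) \<partial>\<nu>)"
      unfolding N_def by (rule nn_integral_distr) measurable
    also have "\<dots> = (\<integral>\<^sup>+x. (1 + ennreal (f n x)) * F (restrict x ?I) \<partial>M)"
      unfolding \<nu>_def by (rule nn_integral_density) measurable
    also have "\<dots> = (\<integral>\<^sup>+x. F (restrict x ?I) + F (restrict x ?I) * ennreal (f n x) \<partial>M)"
      by (simp add: distrib_right mult.commute)
    also have "\<dots> = (\<integral>\<^sup>+x. F (restrict x ?I) \<partial>M) + (\<integral>\<^sup>+x. F (restrict x ?I) * ennreal (f n x) \<partial>M)"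
      by (rule nn_integral_add) measurable
    finally show ?thesis .
  qed
  have "emeasure N (space N) = 1 + 1"
    using N_integral[of "\<lambda>x. 1"] M.emeasure_space_1 f_integral_M by simp
  then have "finite_measure N" by (intro finite_measureI) simp
  then interpret N: finite_measure N .
  interpret block_measure Ch N n
    by unfold_locales (simp add: N_def)
  define h where "h = g \<circ> extend_zero ?I"
  have h_meas: "h \<in> borel_measurable (\<Pi>\<^sub>M i\<in>?I. borel)"
    unfolding h_def by (rule measurable_comp[OF measurable_extend_zero g_meas])
  have h_restr: "h (restrict x ?I) = g x" for x
    unfolding h_def using depends_on_block_extend_zero[OF g_block] by simp
  obtain l g' where g': "cellwise n l g'" "\<And>x. \<bar>g' x\<bar> \<le> real K" "(\<integral>\<^sup>+x. ennreal \<bar>h x - g' x\<bar> \<partial>N) < ennreal \<epsilon>"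
  proof (rule bounded_approximation[of h "real K" \<epsilon>])
    show "h \<in> borel_measurable N" using h_meas by (simp add: N_def)
    show "\<bar>h x\<bar> \<le> real K" for x unfolding h_def using g_bound by simp
  qed (use e in auto)
  have g'_restr: "g' (restrict x ?I) = g' x" for x
    by (rule g'(1)[unfolded cellwise_def, THEN spec, THEN spec, THEN mp]) auto
  have g'_meas [measurable]: "g' \<in> borel_measurable (\<Pi>\<^sub>M i\<in>UNIV. borel)"
    by (rule cellwise_measurable[OF g'(1)]) auto
  have g'_block: "depends_on_block n g'"
    unfolding depends_on_block_def
    by (intro allI impI, rule g'(1)[unfolded cellwise_def, THEN spec, THEN spec, THEN mp]) auto
  let ?d = "\<lambda>x. \<bar>g x - g' x\<bar>"
  have "(\<integral>\<^sup>+x. ennreal \<bar>h x - g' x\<bar> \<partial>N) = (\<integral>\<^sup>+x. ennreal (?d x) \<partial>M) + (\<integral>\<^sup>+x. ennreal (?d x) * ennreal (f n x) \<partial>M)"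
  proof (subst N_integral)
    have [measurable]: "g' \<in> borel_measurable (\<Pi>\<^sub>M i\<in>?I. borel)"
      by (rule cellwise_measurable[OF g'(1)]) auto
    show "(\<lambda>x. ennreal \<bar>h x - g' x\<bar>) \<in> borel_measurable (\<Pi>\<^sub>M i\<in>?I. borel)"
      using h_meas by measurable
  qed (simp add: h_restr g'_restr)
  also have "(\<integral>\<^sup>+x. ennreal (?d x) * ennreal (f n x) \<partial>M) = (\<integral>\<^sup>+x. ennreal (?d x) \<partial>P)"
    by (rule f_density[symmetric])
       (measurable, intro depends_on_block_comp[where g=ennreal] depends_on_block_comp[where g=abs]
          depends_on_block_comp2[where g="(-)"] g_block g'_block)
  finally have sum_lt: "(\<integral>\<^sup>+x. ennreal (?d x) \<partial>M) + (\<integral>\<^sup>+x. ennreal (?d x) \<partial>P) < ennreal \<epsilon>"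
    using g'(3) by simp
  have [measurable]: "g \<in> borel_measurable P" "g \<in> borel_measurable M" "g' \<in> borel_measurable P" "g' \<in> borel_measurable M"
    by measurable
  have gi: "integrable P g" "integrable P g'" "integrable M g" "integrable M g'"
    by (rule integrable_const_bound[where B="real K"] M.integrable_const_bound[where B="real K"];
        use g_bound g'(2) in auto)+
  have dM: "(\<integral>x. ?d x \<partial>M) < \<epsilon>" and dP: "(\<integral>x. ?d x \<partial>P) < \<epsilon>"
  proof -
    have "(\<integral>\<^sup>+x. ennreal (?d x) \<partial>M) < ennreal \<epsilon>" "(\<integral>\<^sup>+x. ennreal (?d x) \<partial>P) < ennreal \<epsilon>"
      using sum_lt by (auto intro: le_less_trans[rotated])
    then show "(\<integral>x. ?d x \<partial>M) < \<epsilon>" "(\<integral>x. ?d x \<partial>P) < \<epsilon>"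
      using nn_integral_eq_integral[of M ?d] nn_integral_eq_integral[of P ?d] gi e
      by (auto simp: ennreal_less_iff)
  qed
  have fi: "integrable M (f n)" and f1: "(\<integral>x. f n x \<partial>M) = 1"
  proof -
    show fi: "integrable M (f n)"
      by (rule integrableI_nonneg) (use f_integral_M[of n] f_nonneg in auto)
    show "(\<integral>x. f n x \<partial>M) = 1"
      using nn_integral_eq_integral[OF fi] f_integral_M[of n] f_nonneg by simp
  qed
  have "(\<integral>x. g' x \<partial>P) \<ge> (\<integral>x. g x - ?d x \<partial>P)"
    by (rule integral_mono) (use gi in auto)
  moreover have "(\<integral>x. g x - ?d x \<partial>P) = (\<integral>x. g x \<partial>P) - (\<integral>x. ?d x \<partial>P)"
    using gi by simp
  moreover have "(\<integral>x. g x \<partial>P) \<ge> (\<integral>x. min (real K) (?L x) \<partial>P)"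
    by (rule integral_mono_AE) (use gi g_ge f_log_integrable[of n] in auto)
  ultimately have lower: "(\<integral>x. g' x \<partial>P) \<ge> (\<integral>x. ?L x \<partial>P) - \<delta> / 4 - \<epsilon>"
    using K(1) dP by linarith
  have "(\<integral>x. 2 powr g' x \<partial>M) \<le> (\<integral>x. f n x + 2 powr (- real K) + 2 powr real K * ln 2 * ?d x \<partial>M)"
  proof (rule integral_mono)
    show "integrable M (\<lambda>x. 2 powr g' x)"
      by (rule M.integrable_const_bound[where B="2 powr real K"]) (use g'(2) in \<open>auto simp: abs_le_iff\<close>)
    show "integrable M (\<lambda>x. f n x + 2 powr (- real K) + 2 powr real K * ln 2 * ?d x)"
      using fi gi by auto
    fix x
    have "2 powr g' x \<le> 2 powr g x + 2 powr real K * ln 2 * \<bar>g' x - g x\<bar>"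
      by (rule powr_2_lipschitz) (use g'(2)[of x] g_bound[of x] in auto)
    then show "2 powr g' x \<le> f n x + 2 powr (- real K) + 2 powr real K * ln 2 * ?d x"
      using g_powr[of x] by (simp add: abs_minus_commute)
  qed
  also have "\<dots> = 1 + 2 powr (- real K) + 2 powr real K * ln 2 * (\<integral>x. ?d x \<partial>M)"
    using fi gi f1 M.prob_space by simp
  also have "\<dots> \<le> 1 + 2 powr (- real K) + 2 powr real K * ln 2 * \<epsilon>"
    using dM by (intro add_left_mono mult_left_mono) auto
  finally have "((\<integral>x. 2 powr g' x \<partial>M) - 1) / ln 2 \<le> (2 powr (- real K) + 2 powr real K * ln 2 * \<epsilon>) / ln 2"
    by (intro divide_right_mono) auto
  also have "\<dots> = 2 powr (- real K) / ln 2 + 2 powr real K * \<epsilon>"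
    by (simp add: add_divide_distrib)
  finally have upper: "((\<integral>x. 2 powr g' x \<partial>M) - 1) / ln 2 \<le> \<delta> / 4 + 2 powr real K * \<epsilon>"
    using K(2) by linarith
  have "\<epsilon> + 2 powr real K * \<epsilon> = \<delta> / 4"
  proof -
    have "c * (\<delta> / (4 * c)) = \<delta> / 4" if "c \<noteq> 0" for c :: real using that by simp
    moreover have "1 + 2 powr real K \<noteq> 0" by (smt (verit) powr_ge_zero)
    ultimately have "(1 + 2 powr real K) * \<epsilon> = \<delta> / 4" unfolding \<epsilon>_def by blast
    then show ?thesis by (simp add: distrib_right)
  qed
  then have "(\<integral>x. ?L x \<partial>P) - \<delta> \<le> (\<integral>x. g' x \<partial>P) - ((\<integral>x. 2 powr g' x \<partial>M) - 1) / ln 2"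
    using lower upper assms by linarith
  moreover obtain G where "g' = (\<lambda>x. G (part.word l n x))" using cellwise_obtain[OF g'(1)] .
  ultimately show ?thesis by (intro exI[of _ l] exI[of _ G]) simp
qed

theorem npd_mixture_rate:
  assumes univ: "\<And>l. universal (Ch l) (R l)"
  shows "AE x in P. (\<forall>n. summable (\<lambda>l. npd_weight l * q.npd l (R l) n x)) \<and>
      (\<forall>n. (\<Sum>l. npd_weight l * q.npd l (R l) n x) > 0) \<and>
      (\<lambda>n. log 2 (\<Sum>l. npd_weight l * q.npd l (R l) n x) / real n) \<longlonglongrightarrow> D"
proof -
  define t where "t l n x = npd_weight l * q.npd l (R l) n x" for l n x
  \<comment> \<open>The series is summed in \<open>ennreal\<close>, where it always has a measurable
    value. \<open>enn2real\<close> sends infinity to 0, so \<open>u\<close> stays below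
    \<open>s\<close> at every point and is a sub-probability density.\<close>
  define s where "s n x = (\<Sum>l. ennreal (t l n x))" for n x
  define u where "u n x = enn2real (s n x)" for n x
  have t_nonneg: "t l n x \<ge> 0" for l n x
    by (simp add: t_def q.npd_nonneg less_imp_le[OF npd_weight_pos])
  have t_meas [measurable]: "t l n \<in> borel_measurable (\<Pi>\<^sub>M i\<in>UNIV. borel)" for l n
    unfolding t_def by measurable
  have s_meas [measurable]: "s n \<in> borel_measurable (\<Pi>\<^sub>M i\<in>UNIV. borel)" for n
    unfolding s_def by measurable
  have t_block: "depends_on_block n (t l n)" for l n
    unfolding t_def[abs_def] by (rule depends_on_block_comp[OF q.npd_block])
  have s_block: "depends_on_block n (s n)" for n
    unfolding depends_on_block_def
  proof (intro allI impI)
    fix x y :: "int \<Rightarrow> real" assume "\<forall>i\<in>{1..int n}. x i = y i"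
    then have "t l n x = t l n y" for l
      by (rule t_block[unfolded depends_on_block_def, THEN spec, THEN spec, THEN mp])
    then show "s n x = s n y" by (simp add: s_def)
  qed
  have s_int: "(\<integral>\<^sup>+x. s n x \<partial>M) \<le> 1" for n
  proof -
    have "(\<integral>\<^sup>+x. s n x \<partial>M) = (\<Sum>l. \<integral>\<^sup>+x. ennreal (t l n x) \<partial>M)"
      unfolding s_def by (rule nn_integral_suminf) measurable
    also have "\<dots> \<le> (\<Sum>l. ennreal (npd_weight l))"
    proof (rule suminf_le)
      fix l
      have "(\<integral>\<^sup>+x. ennreal (t l n x) \<partial>M) = ennreal (npd_weight l) * (\<integral>\<^sup>+x. ennreal (q.npd l (R l) n x) \<partial>M)"
        unfolding t_def
        by (simp add: ennreal_mult q.npd_nonneg less_imp_le[OF npd_weight_pos] nn_integral_cmult)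
      also have "\<dots> \<le> ennreal (npd_weight l) * 1"
        by (intro mult_left_mono q.npd_integral) (use univ[of l] in \<open>auto simp: universal_def\<close>)
      finally show "(\<integral>\<^sup>+x. ennreal (t l n x) \<partial>M) \<le> ennreal (npd_weight l)" by simp
    qed auto
    also have "\<dots> = ennreal (\<Sum>l. npd_weight l)"
      by (rule suminf_ennreal2) (use npd_weight_sums less_imp_le[OF npd_weight_pos] in \<open>auto simp: sums_iff\<close>)
    also have "\<dots> = 1" using npd_weight_sums by (simp add: sums_iff)
    finally show ?thesis .
  qed
  have u_sub: "sub_density \<mu> u"
  proof unfold_locales
    show "u n x \<ge> 0" for n x by (simp add: u_def)
    show "u n \<in> borel_measurable (\<Pi>\<^sub>M i\<in>UNIV. borel)" for n unfolding u_def by measurable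
    show "depends_on_block n (u n)" for n unfolding u_def[abs_def] by (rule depends_on_block_comp[OF s_block])
    fix n
    have "(\<integral>\<^sup>+x. ennreal (u n x) \<partial>M) \<le> (\<integral>\<^sup>+x. s n x \<partial>M)"
      unfolding u_def by (intro nn_integral_mono) (metis ennreal_enn2real_if le_less_linear linorder_not_less nle_le top_greatest zero_le)
    then show "(\<integral>\<^sup>+x. ennreal (u n x) \<partial>M) \<le> 1" using s_int[of n] by (rule order_trans)
  qed
  \<comment> \<open>Finiteness of the \<open>n\<close>-th series concerns only the first
    \<open>n\<close> coordinates, so it passes from \<open>M\<close> to \<open>P\<close>; it makes
    \<open>u\<close> equal to the real series almost surely.\<close>
  have s_fin: "AE x in P. \<forall>n. s n x \<noteq> \<infinity>"
  proof (subst AE_all_countable, rule allI, rule AE_block_transfer)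
    fix n
    have "{x \<in> space (\<Pi>\<^sub>M i\<in>(UNIV :: int set). borel). s n x \<noteq> \<infinity>} \<in> sets (\<Pi>\<^sub>M i\<in>(UNIV :: int set). borel)"
      by measurable
    then show "{x. s n x \<noteq> \<infinity>} \<in> sets (\<Pi>\<^sub>M i\<in>(UNIV :: int set). borel)"
      by (simp add: space_PiM PiE_UNIV_domain)
    show "depends_on_block n (\<lambda>x. s n x \<noteq> \<infinity>)" by (rule depends_on_block_comp[OF s_block])
    show "AE x in M. s n x \<noteq> \<infinity>"
      by (rule nn_integral_PInf_AE) (use s_int[of n] in \<open>auto simp: top_unique\<close>)
  qed
  have "\<forall>l. \<exists>d. (AE x in P. (\<forall>n. q.npd l (R l) n x > 0) \<and> (\<lambda>n. log 2 (q.npd l (R l) n x) / real n) \<longlonglongrightarrow> d) \<and>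
    (\<forall>n G. n \<ge> 1 \<longrightarrow>
      (\<integral>x. G (part.word l n x) \<partial>P) - ((\<integral>x. 2 powr G (part.word l n x) \<partial>M) - 1) / ln 2 \<le> real n * d)"
  proof
    fix l
    show "\<exists>d. (AE x in P. (\<forall>n. q.npd l (R l) n x > 0) \<and> (\<lambda>n. log 2 (q.npd l (R l) n x) / real n) \<longlonglongrightarrow> d) \<and>
      (\<forall>n G. n \<ge> 1 \<longrightarrow>
        (\<integral>x. G (part.word l n x) \<partial>P) - ((\<integral>x. 2 powr G (part.word l n x) \<partial>M) - 1) / ln 2 \<le> real n * d)"
      by (rule q.npd_rate[OF univ[of l]]) (intro exI conjI allI impI, assumption+)
  qed
  then obtain d where
    d: "\<And>l. AE x in P. (\<forall>n. q.npd l (R l) n x > 0) \<and> (\<lambda>n. log 2 (q.npd l (R l) n x) / real n) \<longlonglongrightarrow> d l" and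
    d_ge: "\<And>l n G. n \<ge> 1 \<Longrightarrow>
      (\<integral>x. G (part.word l n x) \<partial>P) - ((\<integral>x. 2 powr G (part.word l n x) \<partial>M) - 1) / ln 2 \<le> real n * d l"
    by (subst (asm) choice_iff) blast
  \<comment> \<open>A block length \<open>n\<close> is chosen with normalized mean log-density above
    \<open>c'\<close>, then a level that loses at most \<open>c' - c\<close> in total, which is at
    most \<open>c' - c\<close> per letter because \<open>n \<ge> 1\<close>.\<close>
  have d_large: "\<exists>l. d l > c" if "c < D" for c
  proof -
    define c' where "c' = (c + D) / 2"
    have c': "c < c'" "c' < D" using that by (auto simp: c'_def)
    have "\<forall>\<^sub>F n in sequentially. (\<integral>x. log 2 (f n x) \<partial>P) / real n > c'"
      by (rule order_tendstoD(1)[OF f_rate c'(2)])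
    then have "\<forall>\<^sub>F n in sequentially. (\<integral>x. log 2 (f n x) \<partial>P) / real n > c' \<and> n \<ge> 1"
      using eventually_ge_at_top[of "1::nat"] by eventually_elim auto
    then obtain n where n: "(\<integral>x. log 2 (f n x) \<partial>P) / real n > c'" "n \<ge> 1"
      by (auto simp: eventually_sequentially)
    obtain l G where "(\<integral>x. log 2 (f n x) \<partial>P) - (c' - c) \<le>
       (\<integral>x. G (part.word l n x) \<partial>P) - ((\<integral>x. 2 powr G (part.word l n x) \<partial>M) - 1) / ln 2"
      using cellwise_relative_entropy[of "c' - c" n] c' by auto
    then have "(\<integral>x. log 2 (f n x) \<partial>P) - (c' - c) \<le> real n * d l"
      using d_ge[OF n(2)] by (rule order_trans)
    moreover have "(\<integral>x. log 2 (f n x) \<partial>P) > real n * c'" using n by (simp add: field_simps)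
    moreover have "real n * (c' - c) \<ge> 1 * (c' - c)" using n c' by (intro mult_right_mono) auto
    ultimately have "real n * c < real n * d l" by (simp add: algebra_simps)
    then show ?thesis using n by (intro exI[of _ l]) simp
  qed
  have "AE x in P. \<forall>j. \<forall>\<^sub>F n in sequentially. u n x \<le> 2 powr ((D + 1 / real (Suc j)) * real n)"
    by (subst AE_all_countable, intro allI sub_density_eventually_le[OF u_sub]) auto
  moreover have "AE x in P. \<forall>l. (\<forall>n. q.npd l (R l) n x > 0) \<and> (\<lambda>n. log 2 (q.npd l (R l) n x) / real n) \<longlonglongrightarrow> d l"
    by (subst AE_all_countable, intro allI d)
  ultimately show ?thesis
    using s_fin
  proof eventually_elim
    case (elim x)
    have pos: "t l n x > 0" for l n using elim(2) by (simp add: t_def npd_weight_pos)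
    have summ: "summable (\<lambda>l. t l n x)" for n
      using elim(3) by (intro summable_suminf_not_top) (auto simp: s_def t_nonneg)
    have u_eq: "u n x = (\<Sum>l. t l n x)" for n
      unfolding u_def s_def using suminf_ennreal2[OF t_nonneg summ] suminf_nonneg[OF summ t_nonneg] by simp
    have u_ge: "t l n x \<le> u n x" for l n
      unfolding u_eq using sum_le_suminf[OF summ, of "{l}" n] t_nonneg by simp
    have u_pos: "u n x > 0" for n using pos[of 0 n] u_ge[of 0 n] by linarith
    have "(\<lambda>n. log 2 (u n x) / real n) \<longlonglongrightarrow> D"
    proof (rule order_tendstoI)
      fix c assume "c < D"
      \<comment> \<open>The level stays fixed as \<open>n\<close> grows, so the price of its weight
        vanishes after division by \<open>n\<close>.\<close>
      then obtain l where l: "d l > c" using d_large by blast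
      have "(\<lambda>n. log 2 (npd_weight l) / real n + log 2 (q.npd l (R l) n x) / real n) \<longlonglongrightarrow> 0 + d l"
        by (intro tendsto_add lim_const_over_n) (use elim(2) in blast)
      then have "\<forall>\<^sub>F n in sequentially. log 2 (npd_weight l) / real n + log 2 (q.npd l (R l) n x) / real n > c"
        by (rule order_tendstoD) (use l in simp)
      then show "\<forall>\<^sub>F n in sequentially. c < log 2 (u n x) / real n"
      proof eventually_elim
        case (elim n)
        have "log 2 (npd_weight l) + log 2 (q.npd l (R l) n x) = log 2 (t l n x)"
          using pos[of l n] npd_weight_pos[of l] unfolding t_def by (subst log_mult) (auto simp: zero_less_mult_iff)
        also have "\<dots> \<le> log 2 (u n x)" using u_ge[of l n] pos[of l n] u_pos[of n] by simp
        finally have "(log 2 (npd_weight l) + log 2 (q.npd l (R l) n x)) / real n \<le> log 2 (u n x) / real n"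
          by (rule divide_right_mono) simp
        then show ?case using elim by (simp add: add_divide_distrib)
      qed
    next
      fix c assume "D < c"
      then obtain j where "inverse (real (Suc j)) < c - D" using reals_Archimedean[of "c - D"] by auto
      then have j: "D + 1 / real (Suc j) < c" by (simp add: inverse_eq_divide)
      show "\<forall>\<^sub>F n in sequentially. log 2 (u n x) / real n < c"
        using elim(1)[rule_format, of j] eventually_ge_at_top[of "1::nat"]
      proof eventually_elim
        case (elim n)
        have "log 2 (u n x) \<le> (D + 1 / real (Suc j)) * real n"
          using elim(1) u_pos[of n] by (simp add: log_le_iff)
        also have "\<dots> < c * real n" using j elim(2) by (intro mult_strict_right_mono) auto
        finally show ?case using elim(2) by (simp add: divide_less_eq)
      qed
    qed
    then show ?case
      using summ u_pos by (simp add: u_eq t_def)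
  qed
qed

end

section \<open>The normal reference measure\<close>

text \<open>A product measure is determined by its values on boxes, where Tonelli splits the
  integral into one factor per coordinate.\<close>

lemma PiM_density_lborel:
  fixes g :: "real \<Rightarrow> real" and J :: "int set"
  assumes J: "finite J" and g [measurable]: "g \<in> borel_measurable borel"
    and prob: "prob_space (density lborel (\<lambda>x. ennreal (g x)))"
  shows "(\<Pi>\<^sub>M i\<in>J. density lborel (\<lambda>x. ennreal (g x))) = density (\<Pi>\<^sub>M i\<in>J. lborel) (\<lambda>x. \<Prod>i\<in>J. ennreal (g (x i)))"
proof -
  interpret G: product_prob_space "\<lambda>_::int. density lborel (\<lambda>x. ennreal (g x))"
    by (rule product_prob_spaceI) (rule prob)
  interpret L: product_sigma_finite "\<lambda>_::int. lborel :: real measure" ..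
  show ?thesis
  proof (rule G.PiM_eqI[symmetric, OF J])
    show "sets (density (\<Pi>\<^sub>M i\<in>J. lborel) (\<lambda>x. \<Prod>i\<in>J. ennreal (g (x i)))) = sets (\<Pi>\<^sub>M i\<in>J. density lborel (\<lambda>x. ennreal (g x)))"
      by (simp, rule sets_PiM_cong) auto
    fix A assume A: "\<And>i. i \<in> J \<Longrightarrow> A i \<in> sets (density lborel (\<lambda>x. ennreal (g x)))"
    then have [measurable]: "A i \<in> sets borel" if "i \<in> J" for i using that by simp
    have "emeasure (density (\<Pi>\<^sub>M i\<in>J. lborel) (\<lambda>x. \<Prod>i\<in>J. ennreal (g (x i)))) (Pi\<^sub>E J A)
       = (\<integral>\<^sup>+x. (\<Prod>i\<in>J. ennreal (g (x i))) * indicator (Pi\<^sub>E J A) x \<partial>(\<Pi>\<^sub>M i\<in>J. lborel))"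
      by (rule emeasure_density) (use J A in \<open>auto intro!: sets_PiM_I_finite\<close>)
    also have "\<dots> = (\<integral>\<^sup>+x. (\<Prod>i\<in>J. ennreal (g (x i)) * indicator (A i) (x i)) \<partial>(\<Pi>\<^sub>M i\<in>J. lborel))"
    proof (rule nn_integral_cong)
      fix x assume x: "x \<in> space (\<Pi>\<^sub>M i\<in>J. lborel :: real measure)"
      have "indicator (Pi\<^sub>E J A) x = (\<Prod>i\<in>J. indicator (A i) (x i) :: ennreal)"
      proof (cases "x \<in> Pi\<^sub>E J A")
        case True
        then show ?thesis by (simp add: PiE_mem)
      next
        case False
        then obtain i where "i \<in> J" "x i \<notin> A i" using x by (auto simp: space_PiM PiE_iff)
        then show ?thesis using False J by (auto simp: prod_zero_iff intro!: bexI[of _ i])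
      qed
      then show "(\<Prod>i\<in>J. ennreal (g (x i))) * indicator (Pi\<^sub>E J A) x = (\<Prod>i\<in>J. ennreal (g (x i)) * indicator (A i) (x i))"
        by (simp add: prod.distrib)
    qed
    also have "\<dots> = (\<Prod>i\<in>J. \<integral>\<^sup>+y. ennreal (g y) * indicator (A i) y \<partial>lborel)"
      by (rule L.product_nn_integral_prod[OF J]) measurable
    also have "\<dots> = (\<Prod>i\<in>J. emeasure (density lborel (\<lambda>x. ennreal (g x))) (A i))"
      by (intro prod.cong refl emeasure_density[symmetric]) auto
    finally show "emeasure (density (\<Pi>\<^sub>M i\<in>J. lborel) (\<lambda>x. \<Prod>i\<in>J. ennreal (g (x i)))) (Pi\<^sub>E J A)
       = (\<Prod>i\<in>J. emeasure (density lborel (\<lambda>x. ennreal (g x))) (A i))" .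
  qed
qed

lemma log_normal_density:
  assumes "\<sigma> > 0"
  shows "log 2 (normal_density m \<sigma> y) = - ((y - m)\<^sup>2 / (2 * \<sigma>\<^sup>2)) * log 2 (exp 1) - log 2 (\<sigma> * sqrt (2 * pi))"
proof -
  have s: "sqrt (2 * pi * \<sigma>\<^sup>2) = \<sigma> * sqrt (2 * pi)"
    using assms by (simp add: real_sqrt_mult)
  have "normal_density m \<sigma> y = exp (- (y - m)\<^sup>2 / (2 * \<sigma>\<^sup>2)) / (\<sigma> * sqrt (2 * pi))"
    by (simp add: normal_density_def s)
  then have "log 2 (normal_density m \<sigma> y) = log 2 (exp (- (y - m)\<^sup>2 / (2 * \<sigma>\<^sup>2))) - log 2 (\<sigma> * sqrt (2 * pi))"
    using assms by (simp add: log_divide)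
  also have "log 2 (exp (- (y - m)\<^sup>2 / (2 * \<sigma>\<^sup>2))) = - ((y - m)\<^sup>2 / (2 * \<sigma>\<^sup>2)) * log 2 (exp 1)"
    by (simp add: log_def)
  finally show ?thesis .
qed

locale normal_reference = stationary_process P
  for P :: "(int \<Rightarrow> real) measure" +
  fixes m \<sigma> :: real
  assumes sigma_pos: "\<sigma> > 0"
    and abs_cont: "absolutely_continuous (leb_n n) (marg_n P n)"
begin

sublocale dominating_product "normal_measure m \<sigma>"
proof (rule dominating_product.intro)
  show "prob_space (normal_measure m \<sigma>)"
    unfolding normal_measure_def by (rule prob_space_normal_density[OF sigma_pos])
  show "sets (normal_measure m \<sigma>) = sets borel"
    by (simp add: normal_measure_def)
qed

text \<open>The chain rule for densities: relative to Lebesgue measure, that of \<open>P\<close>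
  over that of \<open>M\<close>. The Gaussian density vanishes nowhere, so the quotient is a genuine
  density of \<open>P\<close> relative to \<open>M\<close> on the block.\<close>

definition normal_dens_n :: "nat \<Rightarrow> (int \<Rightarrow> real) \<Rightarrow> real" where
  "normal_dens_n n x = dens_n P n x / (\<Prod>i\<in>{1..int n}. normal_density m \<sigma> (x i))"

lemma sets_leb_n [measurable_cong]: "sets (leb_n n) = sets (\<Pi>\<^sub>M i\<in>{1..int n}. borel)"
  unfolding leb_n_def by (rule sets_PiM_cong) auto

lemma restrict_measurable [measurable]:
  "(\<lambda>x. restrict x {1..int n}) \<in> (\<Pi>\<^sub>M i\<in>UNIV. borel) \<rightarrow>\<^sub>M (\<Pi>\<^sub>M i\<in>{1..int n}. borel)"
  by (rule measurable_restrict_subset) auto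

lemma dens_n_measurable [measurable]: "dens_n P n \<in> borel_measurable (\<Pi>\<^sub>M i\<in>UNIV. borel)"
proof -
  have "RN_deriv (leb_n n) (marg_n P n) \<in> borel_measurable (\<Pi>\<^sub>M i\<in>{1..int n}. borel)"
    using borel_measurable_RN_deriv[of "leb_n n" "marg_n P n"] measurable_cong_sets[OF sets_leb_n refl] by blast
  from measurable_compose[OF restrict_measurable this] show ?thesis
    unfolding dens_n_def[abs_def] by measurable
qed

lemma dens_n_block: "depends_on_block n (dens_n P n)"
  unfolding depends_on_block_def
proof (intro allI impI)
  fix x y :: "int \<Rightarrow> real" assume "\<forall>i\<in>{1..int n}. x i = y i"
  then have "restrict x {1..int n} = restrict y {1..int n}" by (intro restrict_ext) auto
  then show "dens_n P n x = dens_n P n y" by (simp add: dens_n_def)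
qed

lemma normal_dens_n_measurable [measurable]: "normal_dens_n n \<in> borel_measurable (\<Pi>\<^sub>M i\<in>UNIV. borel)"
  unfolding normal_dens_n_def[abs_def] by measurable

lemma normal_dens_n_block: "depends_on_block n (normal_dens_n n)"
  unfolding normal_dens_n_def[abs_def]
proof (rule depends_on_block_comp2[OF dens_n_block, where g="(/)"])
  show "depends_on_block n (\<lambda>x. \<Prod>i\<in>{1..int n}. normal_density m \<sigma> (x i))"
    unfolding depends_on_block_def by (intro allI impI prod.cong) auto
qed

lemma nn_integral_normal_dens_n:
  assumes F [measurable]: "F \<in> borel_measurable (\<Pi>\<^sub>M i\<in>UNIV. borel)" and b: "depends_on_block n F"
  shows "(\<integral>\<^sup>+x. F x \<partial>P) = (\<integral>\<^sup>+x. F x * ennreal (normal_dens_n n x) \<partial>M)"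
proof -
  let ?I = "{1..int n}" and ?RN = "RN_deriv (leb_n n) (marg_n P n)"
  let ?\<phi> = "normal_density m \<sigma>"
  interpret L: product_sigma_finite "\<lambda>_::int. lborel :: real measure" ..
  interpret L: sigma_finite_measure "leb_n n"
    unfolding leb_n_def by (rule L.sigma_finite) simp
  have restr_P: "(\<lambda>x. restrict x ?I) \<in> P \<rightarrow>\<^sub>M (\<Pi>\<^sub>M i\<in>?I. borel)"
    unfolding measurable_cong_sets[OF sets_P refl] by (rule restrict_measurable)
  have restr_M: "(\<lambda>x. restrict x ?I) \<in> M \<rightarrow>\<^sub>M (\<Pi>\<^sub>M i\<in>?I. normal_measure m \<sigma>)"
    unfolding M_def by (rule measurable_restrict_subset) auto
  have sets_marg: "sets (marg_n P n) = sets (leb_n n)"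
    by (simp add: marg_n_def sets_leb_n)
  interpret marg: prob_space "marg_n P n"
    unfolding marg_n_def by (rule prob_space_distr[OF restr_P])
  have RN_m [measurable]: "?RN \<in> borel_measurable (leb_n n)" by simp
  have marg: "density (leb_n n) ?RN = marg_n P n"
    by (rule L.density_RN_deriv[OF abs_cont sets_marg])
  have RN_fin: "AE r in leb_n n. ?RN r \<noteq> \<infinity>"
    by (rule L.RN_deriv_finite[OF marg.sigma_finite_measure_axioms abs_cont sets_marg])
  let ?F = "\<lambda>r. F (extend_zero ?I r)" and ?f = "\<lambda>r. normal_dens_n n (extend_zero ?I r)"
  have [measurable]: "?F \<in> borel_measurable (\<Pi>\<^sub>M i\<in>?I. borel)" "?f \<in> borel_measurable (\<Pi>\<^sub>M i\<in>?I. borel)"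
    by (rule measurable_compose[OF measurable_extend_zero]; measurable)+
  have "(\<integral>\<^sup>+x. F x \<partial>P) = (\<integral>\<^sup>+x. ?F (restrict x ?I) \<partial>P)"
    using depends_on_block_extend_zero[OF b] by simp
  also have "\<dots> = (\<integral>\<^sup>+r. ?F r \<partial>marg_n P n)"
    unfolding marg_n_def by (rule nn_integral_distr[symmetric, OF restr_P]) measurable
  also have "\<dots> = (\<integral>\<^sup>+r. ?F r \<partial>density (leb_n n) ?RN)"
    by (simp only: marg)
  also have "\<dots> = (\<integral>\<^sup>+r. ?RN r * ?F r \<partial>leb_n n)"
    by (rule nn_integral_density) measurable
  also have "\<dots> = (\<integral>\<^sup>+r. (\<Prod>i\<in>?I. ennreal (?\<phi> (r i))) * (?F r * ennreal (?f r)) \<partial>leb_n n)"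
  \<comment> \<open>Almost everywhere only: \<open>dens_n\<close> passes through
    \<open>enn2real\<close>, which loses an infinite value of the Radon-Nikodym derivative.\<close>
  proof (rule nn_integral_cong_AE)
    show "AE r in leb_n n. ?RN r * ?F r = (\<Prod>i\<in>?I. ennreal (?\<phi> (r i))) * (?F r * ennreal (?f r))"
      using RN_fin AE_space
    proof eventually_elim
      case (elim r)
      let ?\<Phi> = "\<Prod>i\<in>?I. ?\<phi> (r i)"
      have pos: "?\<Phi> > 0" using sigma_pos by (intro prod_pos) (simp add: normal_density_pos)
      \<comment> \<open>Points of the finite product are \<open>undefined\<close> outside
        \<open>?I\<close>, so padding with zeros and restricting again returns the same
        point.\<close>
      have "r \<in> extensional ?I" using elim(2) by (auto simp: leb_n_def space_PiM PiE_def)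
      then have r: "restrict (extend_zero ?I r) ?I = r"
        by (auto simp: fun_eq_iff extend_zero_def extensional_def restrict_def)
      have "(\<Prod>i\<in>?I. ?\<phi> (extend_zero ?I r i)) = ?\<Phi>"
        by (rule prod.cong) (auto simp: extend_zero_def)
      then have f: "?f r = enn2real (?RN r) / ?\<Phi>"
        by (simp add: normal_dens_n_def dens_n_def r)
      have "(\<Prod>i\<in>?I. ennreal (?\<phi> (r i))) * ennreal (?f r) = ennreal (?\<Phi> * (enn2real (?RN r) / ?\<Phi>))"
        unfolding f using pos by (subst prod_ennreal) (auto simp: ennreal_mult[symmetric])
      also have "\<dots> = ?RN r"
      proof -
        have "c * (a / c) = a" if "c > 0" for a c :: real using that by simp
        from this[OF pos] show ?thesis using elim(1) by (simp add: ennreal_enn2real_if)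
      qed
      finally show ?case by (simp add: mult_ac)
    qed
  qed
  also have "\<dots> = (\<integral>\<^sup>+r. ?F r * ennreal (?f r) \<partial>(\<Pi>\<^sub>M i\<in>?I. normal_measure m \<sigma>))"
  proof -
    have "(\<Pi>\<^sub>M i\<in>?I. normal_measure m \<sigma>) = density (leb_n n) (\<lambda>r. \<Prod>i\<in>?I. ennreal (?\<phi> (r i)))"
      unfolding normal_measure_def leb_n_def
      by (rule PiM_density_lborel) (auto simp: prob_space_normal_density[OF sigma_pos])
    moreover have "(\<integral>\<^sup>+r. ?F r * ennreal (?f r) \<partial>density (leb_n n) (\<lambda>r. \<Prod>i\<in>?I. ennreal (?\<phi> (r i))))
        = (\<integral>\<^sup>+r. (\<Prod>i\<in>?I. ennreal (?\<phi> (r i))) * (?F r * ennreal (?f r)) \<partial>leb_n n)"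
      by (rule nn_integral_density) measurable
    ultimately show ?thesis by simp
  qed
  also have "\<dots> = (\<integral>\<^sup>+r. ?F r * ennreal (?f r) \<partial>distr M (\<Pi>\<^sub>M i\<in>?I. normal_measure m \<sigma>) (\<lambda>x. restrict x ?I))"
    unfolding M_def by (subst product.distr_PiM_restrict_finite) auto
  also have "\<dots> = (\<integral>\<^sup>+x. ?F (restrict x ?I) * ennreal (?f (restrict x ?I)) \<partial>M)"
  proof (rule nn_integral_distr[OF restr_M])
    have sets: "sets (\<Pi>\<^sub>M i\<in>?I. normal_measure m \<sigma>) = sets (\<Pi>\<^sub>M i\<in>?I. borel)"
      by (rule sets_PiM_cong) (auto simp: sets_mu)
    show "(\<lambda>r. ?F r * ennreal (?f r)) \<in> borel_measurable (distr M (\<Pi>\<^sub>M i\<in>?I. normal_measure m \<sigma>) (\<lambda>x. restrict x ?I))"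
      unfolding measurable_distr_eq1 measurable_cong_sets[OF sets refl] by measurable
  qed
  also have "\<dots> = (\<integral>\<^sup>+x. F x * ennreal (normal_dens_n n x) \<partial>M)"
    using depends_on_block_extend_zero[OF b] depends_on_block_extend_zero[OF normal_dens_n_block] by simp
  finally show ?thesis .
qed

sublocale dominated_densities P "normal_measure m \<sigma>" normal_dens_n
proof unfold_locales
  show "normal_dens_n n x \<ge> 0" for n x
    unfolding normal_dens_n_def dens_n_def
    by (intro divide_nonneg_nonneg prod_nonneg) (simp_all add: normal_density_nonneg)
qed (rule normal_dens_n_measurable normal_dens_n_block nn_integral_normal_dens_n; assumption?)+

lemma log_normal_dens_n:
  assumes "normal_dens_n n x > 0"
  shows "log 2 (normal_dens_n n x) = log 2 (dens_n P n x) - (\<Sum>k<n. log 2 (normal_density m \<sigma> (shift_by k x 1)))"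
proof -
  let ?\<phi> = "normal_density m \<sigma>"
  have pos: "?\<phi> y > 0" for y using sigma_pos by (simp add: normal_density_pos)
  define \<Phi> where "\<Phi> = (\<Prod>i\<in>{1..int n}. ?\<phi> (x i))"
  have Pos: "\<Phi> > 0" unfolding \<Phi>_def using pos by (intro prod_pos) auto
  have f: "normal_dens_n n x = dens_n P n x / \<Phi>" by (simp add: normal_dens_n_def \<Phi>_def)
  have d: "dens_n P n x > 0" using assms Pos unfolding f by (simp add: zero_less_divide_iff)
  have "log 2 (\<Prod>i\<in>{1..int n}. ?\<phi> (x i)) = (\<Sum>i\<in>{1..int n}. log 2 (?\<phi> (x i)))"
    unfolding log_def using pos by (subst ln_prod) (auto simp: sum_divide_distrib less_imp_neq[OF pos, symmetric])
  also have "\<dots> = (\<Sum>k<n. log 2 (?\<phi> (shift_by k x 1)))"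
    by (simp add: sum_int_interval shift_by_def add.commute)
  finally show ?thesis
    using d Pos unfolding f \<Phi>_def[symmetric] by (simp add: log_divide)
qed

end

theorem mainTheorem14:
  fixes P :: "(int \<Rightarrow> real) measure" and m \<sigma> h :: real
    and Ch :: "nat \<Rightarrow> real set set" and R :: "nat \<Rightarrow> (int \<Rightarrow> real set) measure"
  assumes "\<sigma> > 0"
    and "nested_partitions Ch"
    and "\<forall>l. universal (Ch l) (R l)"
    and "stationary_ergodic borel P"
    and "\<forall>n. absolutely_continuous (leb_n n) (marg_n P n)"
    and "\<forall>i. integrable P (\<lambda>x. x i)"
    and "\<forall>i. integrable P (\<lambda>x. (x i)\<^sup>2)"
    and "\<forall>n. integrable P (\<lambda>x. log 2 (dens_n P n x))"
    and "(\<lambda>n. (\<integral>x. - log 2 (dens_n P n x) \<partial>P) / real n) \<longlonglongrightarrow> h"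
  shows "AE x in P.
     (\<forall>\<^sub>F n in sequentially.
        summable (\<lambda>l. npd_weight l * npd_level Ch R (normal_measure m \<sigma>) l x n) \<and>
        NPD Ch R (normal_measure m \<sigma>) x n > 0) \<and>
     (\<lambda>n. (- log 2 (NPD Ch R (normal_measure m \<sigma>) x n)
            + (\<Sum>i \<in> {1..int n}. (x i - m)\<^sup>2 / (2 * \<sigma>\<^sup>2)) * log 2 (exp 1)) / real n
          + log 2 (\<sigma> * sqrt (2 * pi))) \<longlonglongrightarrow> h"
proof -
  interpret normal_reference P m \<sigma>
    by unfold_locales (use assms in auto)
  interpret refining_partitions Ch
    by unfold_locales (use assms in auto)
  define b where "b x = log 2 (normal_density m \<sigma> (x 1))" for x :: "int \<Rightarrow> real"
  have b_eq: "b x = - ((x 1 - m)\<^sup>2 / (2 * \<sigma>\<^sup>2)) * log 2 (exp 1) - log 2 (\<sigma> * sqrt (2 * pi))" for x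
    unfolding b_def by (rule log_normal_density[OF assms(1)])
  \<comment> \<open>The square is expanded so that the moment hypotheses apply; they make the
    Gaussian log-density integrable.\<close>
  have "integrable P (\<lambda>x. (x 1)\<^sup>2 - 2 * m * x 1 + m\<^sup>2)"
    using assms(6,7) by auto
  then have "integrable P (\<lambda>x. (x 1 - m)\<^sup>2)"
    by (simp add: power2_diff algebra_simps)
  then have b_int: "integrable P b"
    unfolding b_eq[abs_def] by auto
  let ?E = "\<integral>x. b x \<partial>P" and ?S = "\<lambda>n x. \<Sum>k<n. b (shift_by k x)"
  have S_int: "integrable P (?S n)" for n
    using integrable_shift_by[OF b_int] by (intro Bochner_Integration.integrable_sum)
  have S: "(\<integral>x. ?S n x \<partial>P) = real n * ?E" for n
    using integrable_shift_by[OF b_int] integral_shift_by[OF b_int] by (simp add: Bochner_Integration.integral_sum)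
  have log_f: "AE x in P. log 2 (dens_n P n x) - ?S n x = log 2 (normal_dens_n n x)" for n
    using f_pos[of n] by eventually_elim (simp add: log_normal_dens_n b_def)
  have logf_meas: "(\<lambda>x. log 2 (normal_dens_n n x)) \<in> borel_measurable P" for n
    by measurable
  have logd_int: "integrable P (\<lambda>x. log 2 (dens_n P n x))" for n using assms(8) by blast
  have logf_int: "integrable P (\<lambda>x. log 2 (normal_dens_n n x))" for n
    by (rule integrable_cong_AE_imp[OF Bochner_Integration.integrable_diff[OF logd_int[of n] S_int[of n]] logf_meas])
       (use log_f[of n] in \<open>eventually_elim, simp\<close>)
  have logf_integral: "(\<integral>x. log 2 (normal_dens_n n x) \<partial>P) = (\<integral>x. log 2 (dens_n P n x) \<partial>P) - real n * ?E" for n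
  proof -
    have "(\<integral>x. log 2 (normal_dens_n n x) \<partial>P) = (\<integral>x. log 2 (dens_n P n x) - ?S n x \<partial>P)"
      by (rule integral_cong_AE) (use logf_meas logd_int S_int log_f[of n] in \<open>auto elim: eventually_mono\<close>)
    then show ?thesis using logd_int[of n] S_int[of n] S[of n] by simp
  qed
  \<comment> \<open>Changing the reference from Lebesgue measure to the Gaussian product subtracts
    \<open>?S n\<close>, of mean \<open>n * ?E\<close>, from the log-density, so the rate
    \<open>- h\<close> becomes \<open>- h - ?E\<close>.\<close>
  interpret npd_process P "normal_measure m \<sigma>" normal_dens_n "- h - ?E" Ch
  proof unfold_locales
    have "(\<lambda>n. - ((\<integral>x. - log 2 (dens_n P n x) \<partial>P) / real n) - ?E) \<longlonglongrightarrow> - h - ?E"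
      by (intro tendsto_intros assms(9))
    moreover have "\<forall>\<^sub>F n in sequentially. - ((\<integral>x. - log 2 (dens_n P n x) \<partial>P) / real n) - ?E
        = (\<integral>x. log 2 (normal_dens_n n x) \<partial>P) / real n"
      using eventually_gt_at_top[of "0::nat"] by eventually_elim (simp add: logf_integral diff_divide_distrib)
    ultimately show "(\<lambda>n. (\<integral>x. log 2 (normal_dens_n n x) \<partial>P) / real n) \<longlonglongrightarrow> - h - ?E"
      by (rule Lim_transform_eventually)
  qed (rule logf_int)
  have level: "npd_level Ch R (normal_measure m \<sigma>) l x n = q.npd l (R l) n x" for l x n
    by (simp add: npd_level_def q.npd_def)
  have univ: "universal (Ch l) (R l)" for l using assms(3) by blast
  show ?thesis
    using npd_mixture_rate[of R, OF univ] birkhoff[OF b_int]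
  proof eventually_elim
    case (elim x)
    let ?N = "\<lambda>n. NPD Ch R (normal_measure m \<sigma>) x n"
    let ?L = "\<lambda>n. (\<Sum>i\<in>{1..int n}. (x i - m)\<^sup>2 / (2 * \<sigma>\<^sup>2)) * log 2 (exp 1)"
    \<comment> \<open>The mean \<open>?E\<close> cancels: it enters once through the growth rate of
      NPD and once, by the ergodic theorem, through the Gaussian sum.\<close>
    have "(\<lambda>n. - (log 2 (?N n) / real n) - ?S n x / real n) \<longlonglongrightarrow> - (- h - ?E) - ?E"
      using elim unfolding NPD_def level by (intro tendsto_diff tendsto_minus) auto
    moreover have "\<forall>\<^sub>F n in sequentially. - (log 2 (?N n) / real n) - ?S n x / real n
        = (- log 2 (?N n) + ?L n) / real n + log 2 (\<sigma> * sqrt (2 * pi))"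
      using eventually_gt_at_top[of "0::nat"]
    proof eventually_elim
      case (elim n)
      have "?S n x = - ?L n - real n * log 2 (\<sigma> * sqrt (2 * pi))"
        unfolding b_eq sum_int_interval
        by (simp add: sum_subtractf sum_negf sum_divide_distrib shift_by_def add.commute)
      then show ?case using elim by (simp add: field_simps)
    qed
    ultimately have "(\<lambda>n. (- log 2 (?N n) + ?L n) / real n + log 2 (\<sigma> * sqrt (2 * pi))) \<longlonglongrightarrow> - (- h - ?E) - ?E"
      by (rule Lim_transform_eventually)
    then show ?case
      using elim(1) by (simp add: NPD_def level)
  qed
qed

end
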